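(* Let $\mathcal C$ be a concrete monoidal $W^*$-category with a semi-regular braiding $c$, let $L\in\mathcal C$ be an object with underlying Hilbert space $\mathscr L$, and let $F\in\mathcal U_{\mathcal C}(L\otimes L)$ be a multiplicative unitary in $\mathcal C$. Define $$\hat A(F):=[(\mathrm{id}\otimes\omega)(F)\mid \omega\in\mathcal B(\mathscr L)_*]\subseteq\mathcal B(\mathscr L).$$ Then: (1) $\hat A(F)$ is a subalgebra of $\mathcal B(\mathscr L)$. (2) $[\hat A(F)\mathscr L]=\mathscr L$, i.e. $\hat A(F)$ acts non-degenerately on $\mathscr L$.
   Context: A $W^*$-category is a $C^*$-category whose Hom-spaces are dual Banach spaces; a functor between $W^*$-categories is normal if it is ultraweakly continuous on Hom-spaces. A concrete monoidal $W^*$-category is a monoidal $W^*$-category $(\mathcal C,\otimes,\mathbb 1)$ (with normal bifunctor $\otimes$) together with a normal strong monoidal ($*$-preserving) functor to the category of Hilbert spaces and bounded maps with the Hilbert space tensor product. The Hilbert space underlying $H,K,L\in\mathcal C$ is denoted $\mathscr H,\mathscr K,\mathscr L$; coherence isomorphisms are suppressed and morphisms are identified with the bounded operators they induce. $\mathcal U_{\mathcal C}(X)$ is the set of unitary endomorphisms of $X$ in $\mathcal C$. A braiding $c$ on $\mathcal C$ is a family of natural isomorphisms $c_{X,Y}:X\otimes Y\to Y\otimes X$ with $c_{U,V\otimes W}=(\mathrm{id}_V\otimes c_{U,W})(c_{U,V}\otimes \mathrm{id}_W)$ and $c_{U\otimes V,W}=(c_{U,W}\otimes\mathrm{id}_V)(\mathrm{id}_U\otimes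 c_{V,W})$. $[X]$ denotes the norm-closed linear span of a set $X$ of operators or vectors; $\mathcal K(\mathscr H,\mathscr K)$ denotes the compact operators; $\mathcal B(\mathscr H,\mathscr K)_*$ is the predual (normal functionals). For $X\in\mathcal B(\mathscr H\otimes\mathscr K,\mathscr H'\otimes\mathscr K')$ and $\omega\in\mathcal B(\mathscr K,\mathscr K')_*$, $(\mathrm{id}\otimes\omega)(X)\in\mathcal B(\mathscr H,\mathscr H')$ is the slice. The braiding $c$ is semi-regular if it is unitary and $\mathcal K(\mathscr H,\mathscr K)\subseteq[(\mathrm{id}\otimes\omega)(c_{H,K})\mid\omega\in\mathcal B(\mathscr K,\mathscr H)_*]$ for all $H,K\in\mathcal C$. $F\in\mathcal U_{\mathcal C}(L\otimes L)$ is a multiplicative unitary in $\mathcal C$ if on $L\otimes L\otimes L$ $$F_{23}F_{12}=F_{12}\,(c_{L,L}^{-1})_{12}\,F_{23}\,(c_{L,L})_{12}\,F_{23},$$ where $F_{12}=F\otimes\mathrm{id}_L$, $F_{23}=\mathrm{id}_L\otimes F$, $(c_{L,L})_{12}=c_{L,L}\otimes\mathrm{id}_L$. *)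

theory Defs
  imports "HOL-Analysis.Analysis"
begin

section \<open>Complex vector spaces and complex Hilbert spaces\<close>

class complex_vector = real_vector +
  fixes scaleC :: "complex \<Rightarrow> 'a \<Rightarrow> 'a" (infixr "*\<^sub>C" 75)
  assumes scaleC_add_right: "a *\<^sub>C (x + y) = a *\<^sub>C x + a *\<^sub>C y"
    and scaleC_add_left: "(a + b) *\<^sub>C x = a *\<^sub>C x + b *\<^sub>C x"
    and scaleC_scaleC: "a *\<^sub>C (b *\<^sub>C x) = (a * b) *\<^sub>C x"
    and scaleC_one: "1 *\<^sub>C x = x"
    and scaleC_of_real: "complex_of_real r *\<^sub>C x = r *\<^sub>R x"

global_interpretation complex_vector: vector_space "scaleC :: complex \<Rightarrow> 'a \<Rightarrow> 'a::complex_vector"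
  defines csubspace = complex_vector.subspace
    and cspan = complex_vector.span
  by unfold_locales
    (simp_all add: scaleC_add_right scaleC_add_left scaleC_scaleC scaleC_one)

class complex_normed_vector = complex_vector + real_normed_vector +
  assumes norm_scaleC: "norm (a *\<^sub>C x) = cmod a * norm x"

text \<open>The inner product is antilinear in the first and linear in the second argument.\<close>

class complex_inner = complex_vector + real_inner +
  fixes cinner :: "'a \<Rightarrow> 'a \<Rightarrow> complex"
  assumes cinner_commute: "cinner x y = cnj (cinner y x)"
    and cinner_add_right: "cinner x (y + z) = cinner x y + cinner x z"
    and cinner_scaleC_right: "cinner x (a *\<^sub>C y) = a * cinner x y"
    and inner_eq_Re_cinner: "inner x y = Re (cinner x y)"
begin

subclass complex_normed_vector
proof
  fix a x
  have left: "cinner (a *\<^sub>C x) z = cnj a * cinner x z" for z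
    by (subst cinner_commute, subst cinner_scaleC_right) (simp add: cinner_commute[of x z])
  have "Im (cinner x x) = 0"
    using arg_cong[OF cinner_commute[of x x], of Im] by simp
  hence "Re (cinner (a *\<^sub>C x) (a *\<^sub>C x)) = (cmod a)\<^sup>2 * Re (cinner x x)"
    unfolding left cinner_scaleC_right cmod_power2
    by (simp add: algebra_simps power2_eq_square)
  thus "norm (a *\<^sub>C x) = cmod a * norm x"
    by (simp add: norm_eq_sqrt_inner inner_eq_Re_cinner real_sqrt_mult)
qed

end

class complex_hilbert = complex_inner + complete_space

instantiation complex :: complex_hilbert
begin
definition scaleC_complex :: "complex \<Rightarrow> complex \<Rightarrow> complex"
  where "scaleC_complex a x = a * x"
definition cinner_complex :: "complex \<Rightarrow> complex \<Rightarrow> complex"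
  where "cinner_complex x y = cnj x * y"
instance
  by standard
    (simp_all add: scaleC_complex_def cinner_complex_def algebra_simps inner_complex_def
      scaleR_conv_of_real)
end

lemma bounded_linear_scaleC: "bounded_linear (\<lambda>x::'a::complex_normed_vector. a *\<^sub>C x)"
proof (rule bounded_linear_intro[where K = "cmod a"])
  show "a *\<^sub>C (r *\<^sub>R x) = r *\<^sub>R (a *\<^sub>C x)" for r and x :: 'a
    by (simp add: scaleC_of_real[symmetric] scaleC_scaleC mult.commute)
qed (simp_all add: scaleC_add_right norm_scaleC mult.commute)

instantiation blinfun :: (real_normed_vector, complex_normed_vector) complex_normed_vector
begin
definition scaleC_blinfun :: "complex \<Rightarrow> ('a \<Rightarrow>\<^sub>L 'b) \<Rightarrow> 'a \<Rightarrow>\<^sub>L 'b"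
  where "scaleC_blinfun a T = Blinfun (\<lambda>x. a *\<^sub>C blinfun_apply T x)"

lemma scaleC_blinfun_apply [simp]:
  "blinfun_apply (a *\<^sub>C T) x = a *\<^sub>C blinfun_apply T x" for T :: "'a \<Rightarrow>\<^sub>L 'b"
  unfolding scaleC_blinfun_def
  by (rule bounded_linear_Blinfun_apply[THEN fun_cong])
    (intro bounded_linear_compose[OF bounded_linear_scaleC] blinfun.bounded_linear_right)

instance
proof
  fix a b :: complex and r :: real and S T :: "'a \<Rightarrow>\<^sub>L 'b"
  show "a *\<^sub>C (S + T) = a *\<^sub>C S + a *\<^sub>C T"
    by (rule blinfun_eqI) (simp add: blinfun.add_left scaleC_add_right)
  show "(a + b) *\<^sub>C T = a *\<^sub>C T + b *\<^sub>C T"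
    by (rule blinfun_eqI) (simp add: blinfun.add_left scaleC_add_left)
  show "a *\<^sub>C b *\<^sub>C T = (a * b) *\<^sub>C T"
    by (rule blinfun_eqI) (simp add: scaleC_scaleC)
  show "1 *\<^sub>C T = T"
    by (rule blinfun_eqI) (simp add: scaleC_one)
  show "complex_of_real r *\<^sub>C T = r *\<^sub>R T"
    by (rule blinfun_eqI) (simp add: scaleC_of_real blinfun.scaleR_left)
  have le: "norm (c *\<^sub>C V) \<le> cmod c * norm V" for c and V :: "'a \<Rightarrow>\<^sub>L 'b"
    by (rule norm_blinfun_bound)
      (simp_all add: norm_scaleC mult.assoc mult_left_mono norm_blinfun)
  show "norm (a *\<^sub>C T) = cmod a * norm T"
  proof (cases "a = 0")
    case False
    have "T = inverse a *\<^sub>C a *\<^sub>C T"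
      using False by (intro blinfun_eqI) (simp add: scaleC_scaleC scaleC_one)
    hence "norm T \<le> cmod (inverse a) * norm (a *\<^sub>C T)"
      using le by metis
    hence "cmod a * norm T \<le> norm (a *\<^sub>C T)"
      using False by (simp add: norm_inverse inverse_eq_divide norm_divide field_simps)
    thus ?thesis using le[of a T] by simp
  qed (use le[of 0 T] in simp)
qed
end

text \<open>The bracket $[X]$: norm-closed complex linear span.\<close>

definition closed_cspan :: "'a::complex_normed_vector set \<Rightarrow> 'a set"
  where "closed_cspan S = closure (cspan S)"


section \<open>Operators between Hilbert spaces\<close>

text \<open>
  Hilbert spaces are closed complex subspaces of one ambient Hilbert space of type \<open>'h\<close>.
  A family of Hilbert spaces indexed by a type can always be placed like this (take its
  \<open>l\<^sup>2\<close>-direct sum as the ambient space), and \<open>'h\<close> is arbitrary.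
  A bounded operator from \<open>H\<close> to \<open>K\<close> is represented by its extension by zero on the
  orthogonal complement of \<open>H\<close>. This does not change the operator norm, composition
  is \<open>o\<^sub>L\<close>, and the identity of \<open>H\<close> is the orthogonal projection onto \<open>H\<close>.
\<close>

definition hilbert_subspace :: "'h::complex_hilbert set \<Rightarrow> bool"
  where "hilbert_subspace H \<longleftrightarrow> csubspace H \<and> closed H"

definition bop :: "'h::complex_hilbert set \<Rightarrow> 'h set \<Rightarrow> ('h \<Rightarrow>\<^sub>L 'h) set"
  where "bop H K = {T. (\<forall>a x. blinfun_apply T (a *\<^sub>C x) = a *\<^sub>C blinfun_apply T x) \<and>
    range (blinfun_apply T) \<subseteq> K \<and>
    (\<forall>x. (\<forall>h\<in>H. cinner h x = 0) \<longrightarrow> blinfun_apply T x = 0)}"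

definition compact_ops :: "'h::complex_hilbert set \<Rightarrow> 'h set \<Rightarrow> ('h \<Rightarrow>\<^sub>L 'h) set"
  where "compact_ops H K =
    {T \<in> bop H K. compact (closure (blinfun_apply T ` (H \<inter> cball 0 1)))}"

text \<open>
  The predual of the operators from \<open>H\<close> to \<open>K\<close>: functionals
  $T \mapsto \sum_n \langle y'_n, T y_n\rangle$ with $(y_n)$ and $(y'_n)$ square summable.
  Functionals on a space \<open>M\<close> are functions that vanish outside \<open>M\<close>, so that they
  are determined by their values on \<open>M\<close>.
\<close>

definition normal_functionals ::
    "'h::complex_hilbert set \<Rightarrow> 'h set \<Rightarrow> (('h \<Rightarrow>\<^sub>L 'h) \<Rightarrow> complex) set"
  where "normal_functionals H K = {\<omega>. \<exists>(y :: nat \<Rightarrow> 'h) (y' :: nat \<Rightarrow> 'h).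
    (\<forall>n. y n \<in> H \<and> y' n \<in> K) \<and>
    summable (\<lambda>n. (norm (y n))\<^sup>2) \<and> summable (\<lambda>n. (norm (y' n))\<^sup>2) \<and>
    \<omega> = (\<lambda>T. if T \<in> bop H K then \<Sum>n. cinner (y' n) (blinfun_apply T (y n)) else 0)}"

text \<open>
  \<open>(T, t)\<close> is a Hilbert space tensor product of \<open>H\<close> and \<open>K\<close>, with elementary tensors
  \<open>t x y\<close>. Equivalently, \<open>t\<close> is the composition of $(x,y)\mapsto x\otimes y$ with a
  unitary from any model of the Hilbert space tensor product onto \<open>T\<close>.
\<close>

definition hilbert_tensor ::
    "'h::complex_hilbert set \<Rightarrow> 'h set \<Rightarrow> 'h set \<Rightarrow> ('h \<Rightarrow> 'h \<Rightarrow> 'h) \<Rightarrow> bool"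
  where "hilbert_tensor H K T t \<longleftrightarrow>
    (\<forall>x\<in>H. \<forall>y\<in>K. t x y \<in> T) \<and>
    (\<forall>x\<in>H. \<forall>x'\<in>H. \<forall>y\<in>K. t (x + x') y = t x y + t x' y) \<and>
    (\<forall>x\<in>H. \<forall>y\<in>K. \<forall>y'\<in>K. t x (y + y') = t x y + t x y') \<and>
    (\<forall>a. \<forall>x\<in>H. \<forall>y\<in>K. t (a *\<^sub>C x) y = a *\<^sub>C t x y \<and> t x (a *\<^sub>C y) = a *\<^sub>C t x y) \<and>
    (\<forall>x\<in>H. \<forall>x'\<in>H. \<forall>y\<in>K. \<forall>y'\<in>K. cinner (t x y) (t x' y') = cinner x x' * cinner y y') \<and>
    closed_cspan {t x y | x y. x \<in> H \<and> y \<in> K} = T"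

text \<open>
  Slices of \<open>A : H \<otimes> K \<rightarrow> H' \<otimes> K'\<close>, where \<open>t\<close> and \<open>t'\<close> are the elementary tensors of
  the two products. \<open>matrix_coefficient\<close> is the operator \<open>b : K \<rightarrow> K'\<close> with
  $\langle y', b y\rangle = \langle x'\otimes y', A (x\otimes y)\rangle$, and
  $\langle x', (\mathrm{id}\otimes\omega)(A)\, x\rangle$ is \<open>\<omega>\<close> applied to it.
\<close>

definition matrix_coefficient ::
    "'h::complex_hilbert set \<Rightarrow> 'h set \<Rightarrow> ('h \<Rightarrow> 'h \<Rightarrow> 'h) \<Rightarrow> ('h \<Rightarrow> 'h \<Rightarrow> 'h) \<Rightarrow>
     ('h \<Rightarrow>\<^sub>L 'h) \<Rightarrow> 'h \<Rightarrow> 'h \<Rightarrow> ('h \<Rightarrow>\<^sub>L 'h)"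
  where "matrix_coefficient K K' t t' A x' x = (THE b. b \<in> bop K K' \<and>
    (\<forall>y\<in>K. \<forall>y'\<in>K'. cinner y' (blinfun_apply b y) = cinner (t' x' y') (blinfun_apply A (t x y))))"

definition slice ::
    "'h::complex_hilbert set \<Rightarrow> 'h set \<Rightarrow> 'h set \<Rightarrow> 'h set \<Rightarrow> ('h \<Rightarrow> 'h \<Rightarrow> 'h) \<Rightarrow> ('h \<Rightarrow> 'h \<Rightarrow> 'h) \<Rightarrow>
     (('h \<Rightarrow>\<^sub>L 'h) \<Rightarrow> complex) \<Rightarrow> ('h \<Rightarrow>\<^sub>L 'h) \<Rightarrow> ('h \<Rightarrow>\<^sub>L 'h)"
  where "slice H K H' K' t t' \<omega> A = (THE S. S \<in> bop H H' \<and>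
    (\<forall>x\<in>H. \<forall>x'\<in>H'. cinner x' (blinfun_apply S x) = \<omega> (matrix_coefficient K K' t t' A x' x)))"

definition subalgebra_of_bop :: "'h::complex_hilbert set \<Rightarrow> ('h \<Rightarrow>\<^sub>L 'h) set \<Rightarrow> bool"
  where "subalgebra_of_bop H A \<longleftrightarrow>
    A \<subseteq> bop H H \<and> csubspace A \<and> (\<forall>S\<in>A. \<forall>T\<in>A. S o\<^sub>L T \<in> A)"


section \<open>Dual Banach spaces and ultraweak topologies\<close>

definition bounded_functionals :: "'m::complex_normed_vector set \<Rightarrow> ('m \<Rightarrow> complex) set"
  where "bounded_functionals M = {\<omega>.
    (\<forall>f\<in>M. \<forall>g\<in>M. \<omega> (f + g) = \<omega> f + \<omega> g) \<and> (\<forall>a. \<forall>f\<in>M. \<omega> (a *\<^sub>C f) = a * \<omega> f) \<and>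
    (\<exists>B. \<forall>f\<in>M. cmod (\<omega> f) \<le> B * norm f) \<and> (\<forall>f. f \<notin> M \<longrightarrow> \<omega> f = 0)}"

definition functional_norm :: "'m::complex_normed_vector set \<Rightarrow> ('m \<Rightarrow> complex) \<Rightarrow> real"
  where "functional_norm M \<omega> = Sup {cmod (\<omega> f) | f. f \<in> M \<and> norm f \<le> 1}"

text \<open>
  \<open>M\<close> is the Banach space dual of \<open>E\<close>. A predual may be taken to be a norm-closed subspace
  \<open>E\<close> of the dual of \<open>M\<close>; the last two conditions say that evaluation is an isometric
  isomorphism from \<open>M\<close> onto the dual of \<open>E\<close>.
\<close>

definition is_predual :: "'m::complex_normed_vector set \<Rightarrow> ('m \<Rightarrow> complex) set \<Rightarrow> bool"
  where "is_predual M E \<longleftrightarrow>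
    E \<subseteq> bounded_functionals M \<and> (\<lambda>f. 0) \<in> E \<and>
    (\<forall>\<omega>\<in>E. \<forall>\<omega>'\<in>E. (\<lambda>f. \<omega> f + \<omega>' f) \<in> E) \<and> (\<forall>a. \<forall>\<omega>\<in>E. (\<lambda>f. a * \<omega> f) \<in> E) \<and>
    (\<forall>\<omega>\<in>bounded_functionals M.
      (\<forall>e>0. \<exists>\<omega>'\<in>E. functional_norm M (\<lambda>f. \<omega> f - \<omega>' f) < e) \<longrightarrow> \<omega> \<in> E) \<and>
    (\<forall>f\<in>M. norm f = Sup {cmod (\<omega> f) | \<omega>. \<omega> \<in> E \<and> functional_norm M \<omega> \<le> 1}) \<and>
    (\<forall>\<phi> :: ('m \<Rightarrow> complex) \<Rightarrow> complex.
      (\<forall>\<omega>\<in>E. \<forall>\<omega>'\<in>E. \<phi> (\<lambda>f. \<omega> f + \<omega>' f) = \<phi> \<omega> + \<phi> \<omega>') \<and>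
      (\<forall>a. \<forall>\<omega>\<in>E. \<phi> (\<lambda>f. a * \<omega> f) = a * \<phi> \<omega>) \<and>
      (\<exists>B. \<forall>\<omega>\<in>E. cmod (\<phi> \<omega>) \<le> B * functional_norm M \<omega>)
      \<longrightarrow> (\<exists>f\<in>M. \<forall>\<omega>\<in>E. \<phi> \<omega> = \<omega> f))"

definition weak_topology :: "'m set \<Rightarrow> ('m \<Rightarrow> complex) set \<Rightarrow> 'm topology"
  where "weak_topology M E =
    topology_generated_by {{f \<in> M. \<omega> f \<in> V} | \<omega> V. \<omega> \<in> E \<and> open V}"


section \<open>W*-categories\<close>

text \<open>
  As for Hilbert spaces, the Hom-spaces are closed subspaces of one ambient Banach space
  \<open>'m\<close>. \<open>Predual X Y\<close> is the (unique) predual of \<open>Hom X Y\<close>. Composition \<open>g \<cdot> f\<close> means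
  \<open>g\<close> after \<open>f\<close>.
\<close>

record ('o, 'm) wstar_data =
  Ob :: "'o set"
  Hom :: "'o \<Rightarrow> 'o \<Rightarrow> 'm set"
  Id :: "'o \<Rightarrow> 'm" ("\<iota>\<index>")
  Comp :: "'m \<Rightarrow> 'm \<Rightarrow> 'm" (infixl "\<cdot>\<index>" 70)
  Dag :: "'m \<Rightarrow> 'm" ("_\<dagger>\<index>" [1000] 999)
  Predual :: "'o \<Rightarrow> 'o \<Rightarrow> ('m \<Rightarrow> complex) set"

locale cstar_category =
  fixes C :: "('o, 'm::{complex_normed_vector, banach}, 'x) wstar_data_scheme" (structure)
  assumes Hom_subspace: "\<lbrakk>X \<in> Ob C; Y \<in> Ob C\<rbrakk> \<Longrightarrow> csubspace (Hom C X Y) \<and> closed (Hom C X Y)"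
    and Id_in_Hom: "X \<in> Ob C \<Longrightarrow> \<iota> X \<in> Hom C X X"
    and Comp_in_Hom: "\<lbrakk>X \<in> Ob C; Y \<in> Ob C; Z \<in> Ob C; f \<in> Hom C X Y; g \<in> Hom C Y Z\<rbrakk>
      \<Longrightarrow> g \<cdot> f \<in> Hom C X Z"
    and Comp_assoc: "\<lbrakk>W \<in> Ob C; X \<in> Ob C; Y \<in> Ob C; Z \<in> Ob C;
        f \<in> Hom C W X; g \<in> Hom C X Y; h \<in> Hom C Y Z\<rbrakk> \<Longrightarrow> (h \<cdot> g) \<cdot> f = h \<cdot> (g \<cdot> f)"
    and Comp_Id: "\<lbrakk>X \<in> Ob C; Y \<in> Ob C; f \<in> Hom C X Y\<rbrakk> \<Longrightarrow> f \<cdot> \<iota> X = f \<and> \<iota> Y \<cdot> f = f"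
    and Comp_add_right: "\<lbrakk>X \<in> Ob C; Y \<in> Ob C; Z \<in> Ob C;
        f \<in> Hom C X Y; f' \<in> Hom C X Y; g \<in> Hom C Y Z\<rbrakk> \<Longrightarrow> g \<cdot> (f + f') = g \<cdot> f + g \<cdot> f'"
    and Comp_add_left: "\<lbrakk>X \<in> Ob C; Y \<in> Ob C; Z \<in> Ob C;
        f \<in> Hom C X Y; g \<in> Hom C Y Z; g' \<in> Hom C Y Z\<rbrakk> \<Longrightarrow> (g + g') \<cdot> f = g \<cdot> f + g' \<cdot> f"
    and Comp_scaleC: "\<lbrakk>X \<in> Ob C; Y \<in> Ob C; Z \<in> Ob C; f \<in> Hom C X Y; g \<in> Hom C Y Z\<rbrakk>
      \<Longrightarrow> g \<cdot> (a *\<^sub>C f) = a *\<^sub>C (g \<cdot> f) \<and> (a *\<^sub>C g) \<cdot> f = a *\<^sub>C (g \<cdot> f)"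
    and norm_Comp: "\<lbrakk>X \<in> Ob C; Y \<in> Ob C; Z \<in> Ob C; f \<in> Hom C X Y; g \<in> Hom C Y Z\<rbrakk>
      \<Longrightarrow> norm (g \<cdot> f) \<le> norm g * norm f"
    and Dag_in_Hom: "\<lbrakk>X \<in> Ob C; Y \<in> Ob C; f \<in> Hom C X Y\<rbrakk> \<Longrightarrow> f\<dagger> \<in> Hom C Y X"
    and Dag_Dag: "\<lbrakk>X \<in> Ob C; Y \<in> Ob C; f \<in> Hom C X Y\<rbrakk> \<Longrightarrow> (f\<dagger>)\<dagger> = f"
    and Dag_add: "\<lbrakk>X \<in> Ob C; Y \<in> Ob C; f \<in> Hom C X Y; g \<in> Hom C X Y\<rbrakk>
      \<Longrightarrow> (f + g)\<dagger> = f\<dagger> + g\<dagger>"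
    and Dag_scaleC: "\<lbrakk>X \<in> Ob C; Y \<in> Ob C; f \<in> Hom C X Y\<rbrakk> \<Longrightarrow> (a *\<^sub>C f)\<dagger> = cnj a *\<^sub>C f\<dagger>"
    and Dag_Comp: "\<lbrakk>X \<in> Ob C; Y \<in> Ob C; Z \<in> Ob C; f \<in> Hom C X Y; g \<in> Hom C Y Z\<rbrakk>
      \<Longrightarrow> (g \<cdot> f)\<dagger> = f\<dagger> \<cdot> g\<dagger>"
    and cstar_identity: "\<lbrakk>X \<in> Ob C; Y \<in> Ob C; f \<in> Hom C X Y\<rbrakk>
      \<Longrightarrow> norm (f\<dagger> \<cdot> f) = (norm f)\<^sup>2"
    and cstar_positive: "\<lbrakk>X \<in> Ob C; Y \<in> Ob C; f \<in> Hom C X Y\<rbrakk>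
      \<Longrightarrow> \<exists>g\<in>Hom C X X. f\<dagger> \<cdot> f = g\<dagger> \<cdot> g"

locale wstar_category = cstar_category +
  assumes predual: "\<lbrakk>X \<in> Ob C; Y \<in> Ob C\<rbrakk> \<Longrightarrow> is_predual (Hom C X Y) (Predual C X Y)"

definition ultraweak :: "('o, 'm, 'x) wstar_data_scheme \<Rightarrow> 'o \<Rightarrow> 'o \<Rightarrow> 'm topology"
  where "ultraweak C X Y = weak_topology (Hom C X Y) (Predual C X Y)"

definition unitary :: "('o, 'm, 'x) wstar_data_scheme \<Rightarrow> 'o \<Rightarrow> 'o \<Rightarrow> 'm \<Rightarrow> bool"
  where "unitary C X Y u \<longleftrightarrow> u \<in> Hom C X Y \<and>
    u\<dagger>\<^bsub>C\<^esub> \<cdot>\<^bsub>C\<^esub> u = \<iota>\<^bsub>C\<^esub> X \<and> u \<cdot>\<^bsub>C\<^esub> u\<dagger>\<^bsub>C\<^esub> = \<iota>\<^bsub>C\<^esub> Y"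

definition is_inverse :: "('o, 'm, 'x) wstar_data_scheme \<Rightarrow> 'o \<Rightarrow> 'o \<Rightarrow> 'm \<Rightarrow> 'm \<Rightarrow> bool"
  where "is_inverse C X Y f g \<longleftrightarrow> f \<in> Hom C X Y \<and> g \<in> Hom C Y X \<and>
    g \<cdot>\<^bsub>C\<^esub> f = \<iota>\<^bsub>C\<^esub> X \<and> f \<cdot>\<^bsub>C\<^esub> g = \<iota>\<^bsub>C\<^esub> Y"

definition inv_mor :: "('o, 'm, 'x) wstar_data_scheme \<Rightarrow> 'o \<Rightarrow> 'o \<Rightarrow> 'm \<Rightarrow> 'm"
  where "inv_mor C X Y f = (THE g. is_inverse C X Y f g)"

record ('o, 'm) monoidal_data = "('o, 'm) wstar_data" +
  TenO :: "'o \<Rightarrow> 'o \<Rightarrow> 'o" (infixl "\<odot>\<index>" 75)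
  TenM :: "'m \<Rightarrow> 'm \<Rightarrow> 'm" (infixl "\<otimes>\<index>" 75)
  UnitO :: 'o
  Assoc :: "'o \<Rightarrow> 'o \<Rightarrow> 'o \<Rightarrow> 'm" ("\<alpha>\<index>")
  LUnit :: "'o \<Rightarrow> 'm"
  RUnit :: "'o \<Rightarrow> 'm"

text \<open>
  Normality of the bifunctor is separate ultraweak continuity. The coherence isomorphisms of a
  monoidal W*-category are unitary.
\<close>

locale monoidal_wstar_category = wstar_category C
  for C :: "('o, 'm::{complex_normed_vector, banach}, 'x) monoidal_data_scheme" (structure) +
  assumes TenO_in_Ob: "\<lbrakk>X \<in> Ob C; Y \<in> Ob C\<rbrakk> \<Longrightarrow> X \<odot> Y \<in> Ob C"
    and UnitO_in_Ob: "UnitO C \<in> Ob C"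
    and TenM_in_Hom: "\<lbrakk>X \<in> Ob C; X' \<in> Ob C; Y \<in> Ob C; Y' \<in> Ob C;
        f \<in> Hom C X X'; g \<in> Hom C Y Y'\<rbrakk> \<Longrightarrow> f \<otimes> g \<in> Hom C (X \<odot> Y) (X' \<odot> Y')"
    and TenM_Id: "\<lbrakk>X \<in> Ob C; Y \<in> Ob C\<rbrakk> \<Longrightarrow> \<iota> X \<otimes> \<iota> Y = \<iota> (X \<odot> Y)"
    and TenM_Comp: "\<lbrakk>X \<in> Ob C; X' \<in> Ob C; X'' \<in> Ob C; Y \<in> Ob C; Y' \<in> Ob C; Y'' \<in> Ob C;
        f \<in> Hom C X X'; f' \<in> Hom C X' X''; g \<in> Hom C Y Y'; g' \<in> Hom C Y' Y''\<rbrakk>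
      \<Longrightarrow> (f' \<cdot> f) \<otimes> (g' \<cdot> g) = (f' \<otimes> g') \<cdot> (f \<otimes> g)"
    and TenM_add_left: "\<lbrakk>X \<in> Ob C; X' \<in> Ob C; Y \<in> Ob C; Y' \<in> Ob C;
        f \<in> Hom C X X'; f' \<in> Hom C X X'; g \<in> Hom C Y Y'\<rbrakk>
      \<Longrightarrow> (f + f') \<otimes> g = f \<otimes> g + f' \<otimes> g"
    and TenM_add_right: "\<lbrakk>X \<in> Ob C; X' \<in> Ob C; Y \<in> Ob C; Y' \<in> Ob C;
        f \<in> Hom C X X'; g \<in> Hom C Y Y'; g' \<in> Hom C Y Y'\<rbrakk>
      \<Longrightarrow> f \<otimes> (g + g') = f \<otimes> g + f \<otimes> g'"
    and TenM_scaleC: "\<lbrakk>X \<in> Ob C; X' \<in> Ob C; Y \<in> Ob C; Y' \<in> Ob C;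
        f \<in> Hom C X X'; g \<in> Hom C Y Y'\<rbrakk>
      \<Longrightarrow> (a *\<^sub>C f) \<otimes> g = a *\<^sub>C (f \<otimes> g) \<and> f \<otimes> (a *\<^sub>C g) = a *\<^sub>C (f \<otimes> g)"
    and TenM_Dag: "\<lbrakk>X \<in> Ob C; X' \<in> Ob C; Y \<in> Ob C; Y' \<in> Ob C;
        f \<in> Hom C X X'; g \<in> Hom C Y Y'\<rbrakk> \<Longrightarrow> (f \<otimes> g)\<dagger> = f\<dagger> \<otimes> g\<dagger>"
    and TenM_normal_left: "\<lbrakk>X \<in> Ob C; X' \<in> Ob C; Y \<in> Ob C; Y' \<in> Ob C; g \<in> Hom C Y Y'\<rbrakk>
      \<Longrightarrow> continuous_map (ultraweak C X X') (ultraweak C (X \<odot> Y) (X' \<odot> Y')) (\<lambda>f. f \<otimes> g)"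
    and TenM_normal_right: "\<lbrakk>X \<in> Ob C; X' \<in> Ob C; Y \<in> Ob C; Y' \<in> Ob C; f \<in> Hom C X X'\<rbrakk>
      \<Longrightarrow> continuous_map (ultraweak C Y Y') (ultraweak C (X \<odot> Y) (X' \<odot> Y')) (\<lambda>g. f \<otimes> g)"
    and Assoc_unitary: "\<lbrakk>X \<in> Ob C; Y \<in> Ob C; Z \<in> Ob C\<rbrakk>
      \<Longrightarrow> unitary C (X \<odot> Y \<odot> Z) (X \<odot> (Y \<odot> Z)) (\<alpha> X Y Z)"
    and LUnit_unitary: "X \<in> Ob C \<Longrightarrow> unitary C (UnitO C \<odot> X) X (LUnit C X)"
    and RUnit_unitary: "X \<in> Ob C \<Longrightarrow> unitary C (X \<odot> UnitO C) X (RUnit C X)"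
    and Assoc_natural: "\<lbrakk>X \<in> Ob C; X' \<in> Ob C; Y \<in> Ob C; Y' \<in> Ob C; Z \<in> Ob C; Z' \<in> Ob C;
        f \<in> Hom C X X'; g \<in> Hom C Y Y'; h \<in> Hom C Z Z'\<rbrakk>
      \<Longrightarrow> \<alpha> X' Y' Z' \<cdot> (f \<otimes> g \<otimes> h) = (f \<otimes> (g \<otimes> h)) \<cdot> \<alpha> X Y Z"
    and LUnit_natural: "\<lbrakk>X \<in> Ob C; X' \<in> Ob C; f \<in> Hom C X X'\<rbrakk>
      \<Longrightarrow> LUnit C X' \<cdot> (\<iota> (UnitO C) \<otimes> f) = f \<cdot> LUnit C X"
    and RUnit_natural: "\<lbrakk>X \<in> Ob C; X' \<in> Ob C; f \<in> Hom C X X'\<rbrakk>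
      \<Longrightarrow> RUnit C X' \<cdot> (f \<otimes> \<iota> (UnitO C)) = f \<cdot> RUnit C X"
    and pentagon: "\<lbrakk>W \<in> Ob C; X \<in> Ob C; Y \<in> Ob C; Z \<in> Ob C\<rbrakk>
      \<Longrightarrow> (\<iota> W \<otimes> \<alpha> X Y Z) \<cdot> \<alpha> W (X \<odot> Y) Z \<cdot> (\<alpha> W X Y \<otimes> \<iota> Z) =
          \<alpha> W X (Y \<odot> Z) \<cdot> \<alpha> (W \<odot> X) Y Z"
    and triangle: "\<lbrakk>X \<in> Ob C; Y \<in> Ob C\<rbrakk>
      \<Longrightarrow> (\<iota> X \<otimes> LUnit C Y) \<cdot> \<alpha> X (UnitO C) Y = RUnit C X \<otimes> \<iota> Y"

text \<open>
  A concrete category carries a functor to Hilbert spaces, \<open>X \<mapsto> Sp X\<close> and \<open>f \<mapsto> Op f\<close>. Its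
  unitary structure isomorphisms are recorded through \<open>Tv X Y x y\<close>, the image of the elementary
  tensor $x\otimes y$ in \<open>Sp (X \<odot> Y)\<close>, and \<open>Uv\<close>, the image of $1\in\mathbb C$ in
  \<open>Sp (UnitO C)\<close>. Faithfulness is not required.
\<close>

record (overloaded) ('o, 'm, 'h) concrete_data = "('o, 'm) monoidal_data" +
  Sp :: "'o \<Rightarrow> 'h set"
  Op :: "'m \<Rightarrow> 'h \<Rightarrow>\<^sub>L 'h"
  Tv :: "'o \<Rightarrow> 'o \<Rightarrow> 'h \<Rightarrow> 'h \<Rightarrow> 'h"
  Uv :: 'h

locale concrete_monoidal_wstar_category = monoidal_wstar_category C
  for C :: "('o, 'm::{complex_normed_vector, banach}, 'h::complex_hilbert, 'x)
    concrete_data_scheme" (structure) +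
  assumes Sp_hilbert: "X \<in> Ob C \<Longrightarrow> hilbert_subspace (Sp C X)"
    and Op_in_bop: "\<lbrakk>X \<in> Ob C; Y \<in> Ob C; f \<in> Hom C X Y\<rbrakk> \<Longrightarrow> Op C f \<in> bop (Sp C X) (Sp C Y)"
    and Op_Id: "\<lbrakk>X \<in> Ob C; x \<in> Sp C X\<rbrakk> \<Longrightarrow> Op C (\<iota> X) x = x"
    and Op_Comp: "\<lbrakk>X \<in> Ob C; Y \<in> Ob C; Z \<in> Ob C; f \<in> Hom C X Y; g \<in> Hom C Y Z\<rbrakk>
      \<Longrightarrow> Op C (g \<cdot> f) = Op C g o\<^sub>L Op C f"
    and Op_add: "\<lbrakk>X \<in> Ob C; Y \<in> Ob C; f \<in> Hom C X Y; g \<in> Hom C X Y\<rbrakk>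
      \<Longrightarrow> Op C (f + g) = Op C f + Op C g"
    and Op_scaleC: "\<lbrakk>X \<in> Ob C; Y \<in> Ob C; f \<in> Hom C X Y\<rbrakk> \<Longrightarrow> Op C (a *\<^sub>C f) = a *\<^sub>C Op C f"
    and Op_Dag: "\<lbrakk>X \<in> Ob C; Y \<in> Ob C; f \<in> Hom C X Y; x \<in> Sp C X; y \<in> Sp C Y\<rbrakk>
      \<Longrightarrow> cinner (Op C (f\<dagger>) y) x = cinner y (Op C f x)"
    and Op_normal: "\<lbrakk>X \<in> Ob C; Y \<in> Ob C\<rbrakk> \<Longrightarrow> continuous_map (ultraweak C X Y)
        (weak_topology (bop (Sp C X) (Sp C Y)) (normal_functionals (Sp C X) (Sp C Y))) (Op C)"
    and Tv_tensor: "\<lbrakk>X \<in> Ob C; Y \<in> Ob C\<rbrakk>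
      \<Longrightarrow> hilbert_tensor (Sp C X) (Sp C Y) (Sp C (X \<odot> Y)) (Tv C X Y)"
    and Uv_unit: "norm (Uv C) = 1 \<and> Sp C (UnitO C) = {a *\<^sub>C Uv C | a. True}"
    and Tv_natural: "\<lbrakk>X \<in> Ob C; X' \<in> Ob C; Y \<in> Ob C; Y' \<in> Ob C;
        f \<in> Hom C X X'; g \<in> Hom C Y Y'; x \<in> Sp C X; y \<in> Sp C Y\<rbrakk>
      \<Longrightarrow> Op C (f \<otimes> g) (Tv C X Y x y) = Tv C X' Y' (Op C f x) (Op C g y)"
    and Tv_Assoc: "\<lbrakk>X \<in> Ob C; Y \<in> Ob C; Z \<in> Ob C; x \<in> Sp C X; y \<in> Sp C Y; z \<in> Sp C Z\<rbrakk>
      \<Longrightarrow> Op C (\<alpha> X Y Z) (Tv C (X \<odot> Y) Z (Tv C X Y x y) z) =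
          Tv C X (Y \<odot> Z) x (Tv C Y Z y z)"
    and Tv_LUnit: "\<lbrakk>X \<in> Ob C; x \<in> Sp C X\<rbrakk>
      \<Longrightarrow> Op C (LUnit C X) (Tv C (UnitO C) X (Uv C) x) = x"
    and Tv_RUnit: "\<lbrakk>X \<in> Ob C; x \<in> Sp C X\<rbrakk>
      \<Longrightarrow> Op C (RUnit C X) (Tv C X (UnitO C) x (Uv C)) = x"


section \<open>Braidings and multiplicative unitaries\<close>

locale braiding = monoidal_wstar_category C
  for C :: "('o, 'm::{complex_normed_vector, banach}, 'x) monoidal_data_scheme" (structure)
    and c :: "'o \<Rightarrow> 'o \<Rightarrow> 'm" +
  assumes braiding_iso: "\<lbrakk>X \<in> Ob C; Y \<in> Ob C\<rbrakk> \<Longrightarrow> \<exists>g. is_inverse C (X \<odot> Y) (Y \<odot> X) (c X Y) g"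
    and braiding_natural: "\<lbrakk>X \<in> Ob C; X' \<in> Ob C; Y \<in> Ob C; Y' \<in> Ob C;
        f \<in> Hom C X X'; g \<in> Hom C Y Y'\<rbrakk> \<Longrightarrow> c X' Y' \<cdot> (f \<otimes> g) = (g \<otimes> f) \<cdot> c X Y"
    and hexagon_right: "\<lbrakk>U \<in> Ob C; V \<in> Ob C; W \<in> Ob C\<rbrakk>
      \<Longrightarrow> \<alpha> V W U \<cdot> c U (V \<odot> W) \<cdot> \<alpha> U V W =
          (\<iota> V \<otimes> c U W) \<cdot> \<alpha> V U W \<cdot> (c U V \<otimes> \<iota> W)"
    and hexagon_left: "\<lbrakk>U \<in> Ob C; V \<in> Ob C; W \<in> Ob C\<rbrakk>
      \<Longrightarrow> inv_mor C (W \<odot> U \<odot> V) (W \<odot> (U \<odot> V)) (\<alpha> W U V) \<cdot> c (U \<odot> V) W \<cdot>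
            inv_mor C (U \<odot> V \<odot> W) (U \<odot> (V \<odot> W)) (\<alpha> U V W) =
          (c U W \<otimes> \<iota> V) \<cdot> inv_mor C (U \<odot> W \<odot> V) (U \<odot> (W \<odot> V)) (\<alpha> U W V) \<cdot>
            (\<iota> U \<otimes> c V W)"

definition semi_regular ::
    "('o, 'm, 'h::complex_hilbert, 'x) concrete_data_scheme \<Rightarrow> ('o \<Rightarrow> 'o \<Rightarrow> 'm) \<Rightarrow> bool"
  where "semi_regular C c \<longleftrightarrow>
    (\<forall>X\<in>Ob C. \<forall>Y\<in>Ob C. unitary C (X \<odot>\<^bsub>C\<^esub> Y) (Y \<odot>\<^bsub>C\<^esub> X) (c X Y)) \<and>
    (\<forall>X\<in>Ob C. \<forall>Y\<in>Ob C. compact_ops (Sp C X) (Sp C Y) \<subseteq>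
      closed_cspan {slice (Sp C X) (Sp C Y) (Sp C Y) (Sp C X) (Tv C X Y) (Tv C Y X)
          \<omega> (Op C (c X Y)) | \<omega>. \<omega> \<in> normal_functionals (Sp C Y) (Sp C X)})"

definition leg12 :: "('o, 'm, 'x) monoidal_data_scheme \<Rightarrow> 'o \<Rightarrow> 'm \<Rightarrow> 'm"
  where "leg12 C L f = f \<otimes>\<^bsub>C\<^esub> \<iota>\<^bsub>C\<^esub> L"

definition leg23 :: "('o, 'm, 'x) monoidal_data_scheme \<Rightarrow> 'o \<Rightarrow> 'm \<Rightarrow> 'm"
  where "leg23 C L f =
    inv_mor C (L \<odot>\<^bsub>C\<^esub> L \<odot>\<^bsub>C\<^esub> L) (L \<odot>\<^bsub>C\<^esub> (L \<odot>\<^bsub>C\<^esub> L)) (\<alpha>\<^bsub>C\<^esub> L L L) \<cdot>\<^bsub>C\<^esub>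
      (\<iota>\<^bsub>C\<^esub> L \<otimes>\<^bsub>C\<^esub> f) \<cdot>\<^bsub>C\<^esub> \<alpha>\<^bsub>C\<^esub> L L L"

definition multiplicative_unitary ::
    "('o, 'm, 'x) monoidal_data_scheme \<Rightarrow> ('o \<Rightarrow> 'o \<Rightarrow> 'm) \<Rightarrow> 'o \<Rightarrow> 'm \<Rightarrow> bool"
  where "multiplicative_unitary C c L F \<longleftrightarrow>
    unitary C (L \<odot>\<^bsub>C\<^esub> L) (L \<odot>\<^bsub>C\<^esub> L) F \<and>
    leg23 C L F \<cdot>\<^bsub>C\<^esub> leg12 C L F =
      leg12 C L F \<cdot>\<^bsub>C\<^esub>
      leg12 C L (inv_mor C (L \<odot>\<^bsub>C\<^esub> L) (L \<odot>\<^bsub>C\<^esub> L) (c L L)) \<cdot>\<^bsub>C\<^esub>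
      leg23 C L F \<cdot>\<^bsub>C\<^esub> leg12 C L (c L L) \<cdot>\<^bsub>C\<^esub> leg23 C L F"

definition A_hat ::
    "('o, 'm, 'h::complex_hilbert, 'x) concrete_data_scheme \<Rightarrow> 'o \<Rightarrow> 'm \<Rightarrow> ('h \<Rightarrow>\<^sub>L 'h) set"
  where "A_hat C L F = closed_cspan
    {slice (Sp C L) (Sp C L) (Sp C L) (Sp C L) (Tv C L L) (Tv C L L) \<omega> (Op C F) | \<omega>.
      \<omega> \<in> normal_functionals (Sp C L) (Sp C L)}"

end

theory Submission
  imports Defs
begin

text \<open>
  Write \<open>V X u v\<close> for the slice of \<open>X\<close> by the vector functional of \<open>u\<close> and \<open>v\<close>; these slices
  span \<open>A_hat\<close>. With \<open>k = |x\<rangle>\<langle>y|\<close> one has \<open>V F p x \<circ> V F y q = V (F (1 \<otimes> k) F) p q\<close>.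
  By semi-regularity \<open>k\<close> is a norm limit of combinations of slices of \<open>c\<close>, and for such slices
  \<open>F (1 \<otimes> k) F\<close> is a slice of $F_{12} c_{23} F_{12}$. The hexagon and the naturality of \<open>c\<close>
  give $c_{12} c_{23} F_{12} = F_{23} c_{12} c_{23}$, so the pentagon equation becomes
  $F_{12} c_{23} F_{12} = F_{23} F_{12} F_{23}^* c_{23}$. Slicing the second and third legs of the right-hand
  side only modifies the functional applied to $F_{12}$, hence stays in \<open>A_hat\<close>.
  Non-degeneracy holds because \<open>F\<close> is surjective.
\<close>


section \<open>Complex inner products\<close>

text \<open>The model is the case where c is the flip: its slices by vector functionals are exactly
  the rank-one operators |v><u|. For a general braiding, k is only close in norm to some combination
  D of slices of c, while what has to be close is the slice of F (1 \<otimes> D) F to that of F (1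
  \<otimes> k) F. This calls for the estimate that amplification D \<mapsto> 1 \<otimes> D does not
  increase the norm. Amplification is never constructed for arbitrary D: for a slice of c it is
  itself a slice of c_23, for k it is an explicit product of two operators, and combinations follow
  by linearity. The estimate therefore asks only for an operator with the right values on elementary
  tensors. The functionals that arise on legs two and three come from vectors of L \<otimes> L that
  need not be elementary tensors, so slices of F_12 by arbitrary vectors of L \<otimes> L have to be
  covered; this uses that \<open>A_hat\<close> is closed. Bracketings are kept throughout, and every
  equation is moved from the category to operators before it is used.\<close>

instance complex_hilbert \<subseteq> banach ..

lemma cinner_add_left: "cinner (x + y) z = cinner x z + cinner y (z::'a::complex_inner)"
  by (metis cinner_add_right cinner_commute complex_cnj_add)

lemma cinner_scaleC_left: "cinner (a *\<^sub>C x) y = cnj a * cinner x (y::'a::complex_inner)"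
  by (metis cinner_scaleC_right cinner_commute complex_cnj_mult)

lemma cinner_self: "cinner x x = complex_of_real ((norm (x::'a::complex_inner))\<^sup>2)"
proof (rule complex_eqI)
  show "Re (cinner x x) = Re (complex_of_real ((norm x)\<^sup>2))"
    by (simp add: power2_norm_eq_inner inner_eq_Re_cinner)
  show "Im (cinner x x) = Im (complex_of_real ((norm x)\<^sup>2))"
    using arg_cong[OF cinner_commute[of x x], of Im] by simp
qed

lemma norm_cinner_le: "cmod (cinner x y) \<le> norm x * norm (y::'a::complex_inner)"
proof (cases "cinner x y = 0")
  case False
  \<comment> \<open>The phase that turns \<open>cinner x (a *\<^sub>C y)\<close> into the modulus of
    \<open>cinner x y\<close>, so that the real Cauchy-Schwarz inequality applies.\<close>
  define a where "a = cnj (sgn (cinner x y))"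
  have "cmod a = 1"
    using False by (simp add: a_def norm_sgn)
  have "a * cinner x y = complex_of_real (cmod (cinner x y))"
    using False
    by (simp add: a_def sgn_div_norm scaleR_conv_of_real complex_norm_square[symmetric]
        power2_eq_square field_simps mult.commute)
  hence "cmod (cinner x y) = inner x (a *\<^sub>C y)"
    by (simp add: inner_eq_Re_cinner cinner_scaleC_right)
  also have "\<dots> \<le> norm x * norm (a *\<^sub>C y)"
    by (rule norm_cauchy_schwarz)
  finally show ?thesis
    by (simp add: norm_scaleC \<open>cmod a = 1\<close>)
qed simp

lemma bounded_bilinear_cinner: "bounded_bilinear (cinner :: 'a::complex_inner \<Rightarrow> _)"
proof
  show "cinner (r *\<^sub>R a) b = r *\<^sub>R cinner a b" for r and a b :: 'a
    by (metis cinner_scaleC_left complex_cnj_complex_of_real scaleC_of_real scaleR_conv_of_real)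
  show "cinner a (r *\<^sub>R b) = r *\<^sub>R cinner a b" for r and a b :: 'a
    by (metis cinner_scaleC_right scaleC_of_real scaleR_conv_of_real)
  show "\<exists>K. \<forall>a b :: 'a. norm (cinner a b) \<le> norm a * norm b * K"
    by (metis mult.right_neutral norm_cinner_le)
qed (rule cinner_add_left cinner_add_right)+

interpretation cinner: bounded_bilinear "cinner :: 'a::complex_inner \<Rightarrow> _"
  by (rule bounded_bilinear_cinner)

lemma csubspace_imp_subspace: "csubspace H \<Longrightarrow> subspace (H::'a::complex_vector set)"
  unfolding complex_vector.subspace_def subspace_def by (metis scaleC_of_real)

section \<open>Closed linear spans\<close>

lemma csubspace_closure:
  assumes "csubspace (S::'a::complex_normed_vector set)"
  shows "csubspace (closure S)"
proof (rule complex_vector.subspaceI)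
  show "0 \<in> closure S"
    using complex_vector.subspace_0[OF assms] closure_subset by blast
  fix x y assume "x \<in> closure S" "y \<in> closure S"
  then show "x + y \<in> closure S"
    unfolding closure_sequential
    by (metis (no_types, lifting) complex_vector.subspace_add[OF assms] tendsto_add)
next
  fix a x assume "x \<in> closure S"
  moreover have "(\<lambda>x. a *\<^sub>C x) ` closure S \<subseteq> closure S"
  proof (rule image_closure_subset)
    show "continuous_on (closure S) (\<lambda>x. a *\<^sub>C x)"
      by (rule linear_continuous_on[OF bounded_linear_scaleC])
    show "(\<lambda>x. a *\<^sub>C x) ` S \<subseteq> closure S"
      using complex_vector.subspace_scale[OF assms] closure_subset by blast
  qed auto
  ultimately show "a *\<^sub>C x \<in> closure S" by blast
qed

lemma csubspace_closed_cspan: "csubspace (closed_cspan S)"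
  unfolding closed_cspan_def by (rule csubspace_closure) simp

lemma closed_closed_cspan: "closed (closed_cspan S)"
  by (simp add: closed_cspan_def)

lemma closed_cspan_superset: "S \<subseteq> closed_cspan S"
  unfolding closed_cspan_def
  using closure_subset complex_vector.span_superset by blast

lemma closed_cspan_minimal:
  assumes "S \<subseteq> M" "csubspace M" "closed M"
  shows "closed_cspan S \<subseteq> M"
  unfolding closed_cspan_def
  by (rule closure_minimal[OF complex_vector.span_minimal]) (use assms in auto)

text \<open>The preimage of \<open>M\<close> under \<open>f\<close> is a closed complex subspace.
  The scalar \<open>b\<close> is left free so that antilinear maps are covered as well: a slice is
  antilinear in the vector on its left.\<close>

lemma closed_cspan_induct:
  fixes f :: "'a::complex_normed_vector \<Rightarrow> 'b::complex_normed_vector"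
  assumes "x \<in> closed_cspan S" and "bounded_linear f"
    and f_scale: "\<And>a x. \<exists>b. f (a *\<^sub>C x) = b *\<^sub>C f x"
    and "\<And>x. x \<in> S \<Longrightarrow> f x \<in> M" and "csubspace M" "closed M"
  shows "f x \<in> M"
proof -
  interpret f: bounded_linear f by fact
  have "csubspace (f -` M)"
  proof (rule complex_vector.subspaceI)
    show "a *\<^sub>C x \<in> f -` M" if "x \<in> f -` M" for a x
      using f_scale[of a x] that complex_vector.subspace_scale[OF \<open>csubspace M\<close>] by fastforce
  qed (auto simp: f.add f.zero complex_vector.subspace_0[OF \<open>csubspace M\<close>]
      complex_vector.subspace_add[OF \<open>csubspace M\<close>])
  moreover have "closed (f -` M)"
    by (rule continuous_closed_vimage[OF \<open>closed M\<close>]) (rule f.isCont[OF continuous_ident])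
  ultimately have "closed_cspan S \<subseteq> f -` M"
    by (intro closed_cspan_minimal) (use assms in auto)
  thus ?thesis using assms(1) by auto
qed

section \<open>Riesz representation, projections and adjoints\<close>

lemma riesz_real:
  fixes f :: "'a::{real_inner, complete_space} \<Rightarrow> real"
  assumes "subspace K" "closed K" "bounded_linear f"
  shows "\<exists>z\<in>K. \<forall>y\<in>K. inner z y = f y"
proof -
  \<comment> \<open>The representing vector minimises the following functional on \<open>K\<close>.\<close>
  define J where "J y = (norm y)\<^sup>2 - 2 * f y" for y
  interpret f: bounded_linear f by fact
  obtain B where B: "norm (f x) \<le> norm x * B" for x
    using f.bounded by blast
  have "- B\<^sup>2 \<le> J y" for y
  proof -
    have "0 \<le> (norm y - B)\<^sup>2" by simp
    thus ?thesis
      using B[of y] by (simp add: J_def power2_eq_square algebra_simps)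
  qed
  hence bdd: "bdd_below (J ` K)" by (auto intro!: bdd_belowI)
  define m where "m = Inf (J ` K)"
  have m: "m \<le> J y" if "y \<in> K" for y
    unfolding m_def using bdd that by (rule cINF_lower)
  have "K \<noteq> {}" using subspace_0[OF assms(1)] by blast
  have "\<exists>y\<in>K. J y < m + 1 / Suc n" for n
    by (subst cINF_less_iff[OF \<open>K \<noteq> {}\<close> bdd, symmetric]) (simp add: m_def)
  then obtain y where yK: "\<And>n. y n \<in> K" and y: "\<And>n. J (y n) < m + 1 / Suc n"
    by metis
  have dist2: "(norm (y n - y k))\<^sup>2 \<le> 2 / Suc n + 2 / Suc k" for n k
  proof -
    let ?w = "(1/2) *\<^sub>R (y n + y k)"
    have "m \<le> J ?w"
      by (intro m subspace_mul subspace_add assms yK)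
    \<comment> \<open>Parallelogram law; the terms in \<open>f\<close> cancel because
      \<open>?w\<close> is the midpoint. Since \<open>m \<le> J ?w\<close>, two almost minimal
      vectors must be close to each other.\<close>
    moreover have "(norm (y n - y k))\<^sup>2 = 2 * J (y n) + 2 * J (y k) - 4 * J ?w"
      unfolding J_def
      by (simp only: power2_norm_eq_inner f.scaleR f.add)
        (simp add: algebra_simps inner_commute)
    ultimately show ?thesis using y[of n] y[of k] by simp
  qed
  have "Cauchy y"
  proof (rule metric_CauchyI)
    fix e :: real assume "0 < e"
    then obtain N where N: "4 / Suc N < e\<^sup>2"
      using reals_Archimedean[of "e\<^sup>2 / 4"] by (auto simp: field_simps)
    have "dist (y n) (y k) < e" if "n \<ge> N" "k \<ge> N" for n k
    proof -
      have "2 / Suc n \<le> 2 / Suc N" "2 / Suc k \<le> 2 / Suc N"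
        using that by (simp_all add: frac_le)
      hence "(norm (y n - y k))\<^sup>2 < e\<^sup>2"
        using dist2[of n k] N by linarith
      thus ?thesis
        using \<open>0 < e\<close> by (simp add: dist_norm power_less_imp_less_base)
    qed
    thus "\<exists>M. \<forall>m\<ge>M. \<forall>n\<ge>M. dist (y m) (y n) < e" by blast
  qed
  then obtain z where z: "y \<longlonglongrightarrow> z"
    using Cauchy_convergent_iff convergent_def by blast
  have "z \<in> K"
    using closed_sequentially[OF assms(2)] yK z by blast
  have "(\<lambda>n. J (y n)) \<longlonglongrightarrow> J z"
    unfolding J_def by (intro tendsto_intros z f.tendsto)
  moreover have "(\<lambda>n. m + 1 / Suc n) \<longlonglongrightarrow> m + 0"
    by (intro tendsto_add tendsto_const LIMSEQ_Suc[OF lim_1_over_n])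
  ultimately have "J z \<le> m + 0"
    by (rule LIMSEQ_le) (use y less_imp_le in blast)
  have "inner z w = f w" if "w \<in> K" for w
  proof (cases "w = 0")
    case False
    define d where "d = inner z w - f w"
    \<comment> \<open>The minimiser over s of the quadratic \<open>J (z + s *\<^sub>R w)\<close>.
      Minimality of \<open>z\<close> against this single s already forces
      \<open>d = 0\<close>.\<close>
    define s where "s = - d / (norm w)\<^sup>2"
    have "J z \<le> J (z + s *\<^sub>R w)"
      using m[of "z + s *\<^sub>R w"] \<open>J z \<le> m + 0\<close> \<open>z \<in> K\<close> that assms(1)
      by (simp add: subspace_add subspace_mul)
    also have "J (z + s *\<^sub>R w) = J z + s\<^sup>2 * (norm w)\<^sup>2 + 2 * s * d"
      unfolding J_def d_def
      by (simp only: power2_norm_eq_inner f.scaleR f.add)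
        (simp add: algebra_simps inner_commute power2_eq_square)
    finally have "0 \<le> s\<^sup>2 * (norm w)\<^sup>2 + 2 * s * d" by simp
    also have "\<dots> = - (d\<^sup>2 / (norm w)\<^sup>2)"
      using False by (simp add: s_def power2_eq_square field_simps)
    finally have "d\<^sup>2 \<le> 0"
      using False by (simp add: divide_le_0_iff)
    thus ?thesis by (simp add: d_def)
  qed simp
  thus ?thesis using \<open>z \<in> K\<close> by blast
qed

lemma riesz_complex:
  fixes f :: "'a::complex_hilbert \<Rightarrow> complex"
  assumes "hilbert_subspace K" "bounded_linear f" "\<And>a x. f (a *\<^sub>C x) = a * f x"
  shows "\<exists>z\<in>K. \<forall>y\<in>K. cinner z y = f y"
proof -
  have K: "csubspace K" "closed K" using assms(1) by (auto simp: hilbert_subspace_def)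
  obtain z where z: "z \<in> K" "\<And>y. y \<in> K \<Longrightarrow> inner z y = Re (f y)"
    using riesz_real[OF csubspace_imp_subspace[OF K(1)] K(2)
        bounded_linear_compose[OF bounded_linear_Re assms(2)]] by blast
  have "cinner z y = f y" if "y \<in> K" for y
  proof (rule complex_eqI)
    show "Re (cinner z y) = Re (f y)"
      using z(2)[OF that] by (simp add: inner_eq_Re_cinner)
    \<comment> \<open>Multiplication by -\<i> turns the imaginary part into a real part, where
      \<open>z\<close> is already known to represent \<open>f\<close>.\<close>
    have "inner z ((- \<i>) *\<^sub>C y) = Re (f ((- \<i>) *\<^sub>C y))"
      using that K(1) by (intro z complex_vector.subspace_scale)
    thus "Im (cinner z y) = Im (f y)"
      by (simp only: inner_eq_Re_cinner cinner_scaleC_right assms(3)) simp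
  qed
  thus ?thesis using z(1) by blast
qed

lemma hilbert_subspaceD:
  assumes "hilbert_subspace H"
  shows "0 \<in> H" "\<And>x y. x \<in> H \<Longrightarrow> y \<in> H \<Longrightarrow> x + y \<in> H"
    "\<And>x y. x \<in> H \<Longrightarrow> y \<in> H \<Longrightarrow> x - y \<in> H" "\<And>a x. x \<in> H \<Longrightarrow> a *\<^sub>C x \<in> H"
  using assms unfolding hilbert_subspace_def
  by (auto intro: complex_vector.subspace_0 complex_vector.subspace_add
      complex_vector.subspace_diff complex_vector.subspace_scale)

lemma cinner_eqI:
  assumes "hilbert_subspace H" "x \<in> H" "y \<in> H" "\<And>h. h \<in> H \<Longrightarrow> cinner h x = cinner h y"
  shows "x = y"
proof -
  have "cinner (x - y) (x - y) = 0"
    using assms hilbert_subspaceD(3)[OF assms(1)] by (simp add: cinner.diff_right)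
  thus ?thesis by (simp add: cinner_self)
qed

lemma hilbert_subspace_UNIV: "hilbert_subspace UNIV"
  by (simp add: hilbert_subspace_def complex_vector.subspace_UNIV)

text \<open>A map given only by its inner products against \<open>H\<close> inherits linearity from
  the right argument of \<open>cinner\<close>, and its bound comes from testing with h = g x. Taking
  the identity for \<open>T\<close> yields projections, and taking an operator yields its
  adjoint.\<close>

lemma bounded_linear_of_cinner_bound:
  fixes g :: "'a::complex_hilbert \<Rightarrow> 'b::complex_hilbert"
  assumes H: "hilbert_subspace H" and g: "\<And>x. g x \<in> H"
    and eq: "\<And>h x. h \<in> H \<Longrightarrow> cinner h (g x) = cinner (T h) x"
    and T: "\<And>h. norm (T h) \<le> norm h * B" and "0 \<le> B"
  shows "bounded_linear g" and "g (a *\<^sub>C x) = a *\<^sub>C g x"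
proof -
  have scale: "g (a *\<^sub>C x) = a *\<^sub>C g x" for a x
    by (rule cinner_eqI[OF H]) (simp_all add: g eq hilbert_subspaceD[OF H] cinner_scaleC_right)
  thus "g (a *\<^sub>C x) = a *\<^sub>C g x" .
  show "bounded_linear g"
  proof (rule bounded_linear_intro)
    show "g (x + y) = g x + g y" for x y
      by (rule cinner_eqI[OF H]) (simp_all add: g eq hilbert_subspaceD[OF H] cinner_add_right)
    show "g (r *\<^sub>R x) = r *\<^sub>R g x" for r x
      using scale[of "complex_of_real r" x] by (simp add: scaleC_of_real)
    show "norm (g x) \<le> norm x * B" for x
    proof (cases "g x = 0")
      case True
      thus ?thesis using \<open>0 \<le> B\<close> by simp
    next
      case False
      have "(norm (g x))\<^sup>2 = cmod (cinner (g x) (g x))"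
        by (simp add: cinner_self norm_power)
      also have "\<dots> \<le> norm (T (g x)) * norm x"
        by (simp add: eq g norm_cinner_le)
      also have "\<dots> \<le> norm (g x) * B * norm x"
        by (intro mult_right_mono T) simp
      finally show ?thesis using False
        by (simp add: power2_eq_square mult.assoc mult.commute)
    qed
  qed
qed


section \<open>Orthogonal projections, adjoints and operators between closed subspaces\<close>

definition complex_linear :: "('h::complex_hilbert \<Rightarrow>\<^sub>L 'h) \<Rightarrow> bool"
  where "complex_linear T \<longleftrightarrow> (\<forall>a x. blinfun_apply T (a *\<^sub>C x) = a *\<^sub>C blinfun_apply T x)"

definition hproj :: "'h::complex_hilbert set \<Rightarrow> 'h \<Rightarrow>\<^sub>L 'h"
  where "hproj H = Blinfun (\<lambda>x. SOME p. p \<in> H \<and> (\<forall>h\<in>H. cinner h p = cinner h x))"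

definition adj :: "('h::complex_hilbert \<Rightarrow>\<^sub>L 'h) \<Rightarrow> 'h \<Rightarrow>\<^sub>L 'h"
  where "adj T = Blinfun (\<lambda>x. SOME z. \<forall>y. cinner z y = cinner x (blinfun_apply T y))"

lemma hproj:
  assumes H: "hilbert_subspace H"
  shows hproj_in: "blinfun_apply (hproj H) x \<in> H"
    and cinner_hproj: "h \<in> H \<Longrightarrow> cinner h (blinfun_apply (hproj H) x) = cinner h x"
    and complex_linear_hproj: "complex_linear (hproj H)"
proof -
  define g where "g x = (SOME p. p \<in> H \<and> (\<forall>h\<in>H. cinner h p = cinner h x))" for x
  have ex: "\<exists>p. p \<in> H \<and> (\<forall>h\<in>H. cinner h p = cinner h x)" for x
  proof -
    obtain z where "z \<in> H" "\<And>y. y \<in> H \<Longrightarrow> cinner z y = cinner x y"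
      using riesz_complex[OF H cinner.bounded_linear_right cinner_scaleC_right] by blast
    thus ?thesis by (metis cinner_commute)
  qed
  have g: "g x \<in> H" "\<And>h. h \<in> H \<Longrightarrow> cinner h (g x) = cinner h x" for x
    unfolding g_def using someI_ex[OF ex[of x]] by blast+
  note g_linear = bounded_linear_of_cinner_bound[OF H g, where B = 1, simplified]
  have lin: "bounded_linear g" by (rule g_linear)
  have sc: "g (a *\<^sub>C x) = a *\<^sub>C g x" for a x by (rule g_linear)
  have "blinfun_apply (hproj H) = g"
    unfolding hproj_def g_def[symmetric] by (rule bounded_linear_Blinfun_apply[OF lin])
  thus "blinfun_apply (hproj H) x \<in> H" "complex_linear (hproj H)"
    "h \<in> H \<Longrightarrow> cinner h (blinfun_apply (hproj H) x) = cinner h x"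
    by (simp_all add: g complex_linear_def sc)
qed

lemma cinner_adj:
  assumes "complex_linear T"
  shows "cinner (blinfun_apply (adj T) x) y = cinner x (blinfun_apply T y)" and "complex_linear (adj T)"
proof -
  define g where "g x = (SOME z. \<forall>y. cinner z y = cinner x (blinfun_apply T y))" for x
  have ex: "\<exists>z. \<forall>y. cinner z y = cinner x (blinfun_apply T y)" for x
    using riesz_complex[OF hilbert_subspace_UNIV
        bounded_linear_compose[OF cinner.bounded_linear_right blinfun.bounded_linear_right], of x T]
      assms by (auto simp: complex_linear_def cinner_scaleC_right)
  have g: "cinner (g x) y = cinner x (blinfun_apply T y)" for x y
    unfolding g_def using someI_ex[OF ex[of x]] by blast
  have g': "cinner y (g x) = cinner (blinfun_apply T y) x" for x y
    by (metis cinner_commute g)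
  note g_linear = bounded_linear_of_cinner_bound[OF hilbert_subspace_UNIV UNIV_I g',
      where B = "norm T"]
  have T_le: "norm (blinfun_apply T h) \<le> norm h * norm T" for h
    by (metis mult.commute norm_blinfun)
  have lin: "bounded_linear g"
    by (rule g_linear[OF T_le]) simp
  have sc: "g (a *\<^sub>C x) = a *\<^sub>C g x" for a x
    by (rule g_linear[OF T_le]) simp
  have "blinfun_apply (adj T) = g"
    unfolding adj_def g_def[symmetric] by (rule bounded_linear_Blinfun_apply[OF lin])
  thus "cinner (blinfun_apply (adj T) x) y = cinner x (blinfun_apply T y)" "complex_linear (adj T)"
    by (simp_all add: g complex_linear_def sc)
qed

lemma cinner_adj_right:
  assumes "complex_linear T"
  shows "cinner x (blinfun_apply (adj T) y) = cinner (blinfun_apply T x) y"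
  by (metis assms cinner_adj(1) cinner_commute)

lemma norm_adj_le:
  assumes "complex_linear T"
  shows "norm (adj T) \<le> norm T"
proof (rule norm_blinfun_bound)
  fix x
  let ?z = "blinfun_apply (adj T) x"
  have "(norm ?z)\<^sup>2 = cmod (cinner ?z ?z)"
    by (simp add: cinner_self norm_power)
  also have "\<dots> \<le> norm x * norm (blinfun_apply T ?z)"
    by (simp add: cinner_adj[OF assms] norm_cinner_le)
  also have "\<dots> \<le> norm x * (norm T * norm ?z)"
    by (intro mult_left_mono norm_blinfun) simp
  finally show "norm ?z \<le> norm T * norm x"
    by (cases "?z = 0") (simp_all add: power2_eq_square ac_simps)
qed simp

lemma hproj_ident:
  assumes "hilbert_subspace H" "x \<in> H"
  shows "blinfun_apply (hproj H) x = x"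
  by (rule cinner_eqI[OF assms(1) hproj_in[OF assms(1)] assms(2)])
    (rule cinner_hproj[OF assms(1)])

lemma norm_hproj_le:
  assumes "hilbert_subspace H"
  shows "norm (blinfun_apply (hproj H) x) \<le> norm x"
proof -
  let ?z = "blinfun_apply (hproj H) x"
  have "(norm ?z)\<^sup>2 = cmod (cinner ?z ?z)"
    by (simp add: cinner_self norm_power)
  also have "\<dots> \<le> norm ?z * norm x"
    by (simp add: cinner_hproj[OF assms] hproj_in[OF assms] norm_cinner_le)
  finally show ?thesis
    by (cases "?z = 0") (simp_all add: power2_eq_square)
qed

text \<open>The difference of x and its projection is orthogonal to \<open>H\<close>, so vanishing
  on the orthogonal complement is the same as absorbing \<open>hproj H\<close> on the right. In this
  form an operator is visibly determined by its values on \<open>H\<close>.\<close>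

lemma bop_iff:
  assumes H: "hilbert_subspace H"
  shows "T \<in> bop H K \<longleftrightarrow> complex_linear T \<and> (\<forall>x. blinfun_apply T x \<in> K) \<and>
    (\<forall>x. blinfun_apply T (blinfun_apply (hproj H) x) = blinfun_apply T x)"
    (is "?l \<longleftrightarrow> ?r")
proof
  assume l: ?l
  have "blinfun_apply T (x - blinfun_apply (hproj H) x) = 0" for x
    using l cinner_hproj[OF H] by (simp add: bop_def cinner.diff_right)
  with l show ?r
    by (auto simp: bop_def complex_linear_def blinfun.diff_right)
next
  assume r: ?r
  have "blinfun_apply T x = 0" if "\<forall>h\<in>H. cinner h x = 0" for x
  proof -
    have "blinfun_apply (hproj H) x = 0"
      by (rule cinner_eqI[OF H hproj_in[OF H] hilbert_subspaceD(1)[OF H]])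
        (simp add: cinner_hproj[OF H] that cinner.zero_right)
    thus ?thesis using r blinfun.zero_right by metis
  qed
  with r show ?l
    by (auto simp: bop_def complex_linear_def)
qed

lemma bopD:
  assumes "T \<in> bop H K"
  shows "complex_linear T" "blinfun_apply T x \<in> K"
  using assms by (auto simp: bop_def complex_linear_def)

lemma bop_compose:
  assumes "S \<in> bop K M" "T \<in> bop H K"
  shows "S o\<^sub>L T \<in> bop H M"
  using assms by (auto simp: bop_def blinfun.zero_right)

text \<open>The two support conditions are exchanged by duality: T = T P with P the projection onto
  \<open>H\<close> puts the range of the adjoint into \<open>H\<close>, and the range of T lying in
  \<open>K\<close> makes the adjoint vanish on the complement of \<open>K\<close>.\<close>

lemma bop_adj:
  assumes H: "hilbert_subspace H" and T: "T \<in> bop H K"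
  shows "adj T \<in> bop K H"
proof -
  have T': "complex_linear T" "\<And>x. blinfun_apply T (blinfun_apply (hproj H) x) = blinfun_apply T x"
    using T by (auto simp: bop_iff[OF H])
  have "blinfun_apply (adj T) x \<in> H" for x
  proof -
    have "blinfun_apply (adj T) x = blinfun_apply (hproj H) (blinfun_apply (adj T) x)"
    proof (rule cinner_eqI[OF hilbert_subspace_UNIV])
      fix y
      have "cinner (blinfun_apply (hproj H) y) (blinfun_apply (hproj H) z)
          = cinner y (blinfun_apply (hproj H) z)" for z
        by (metis cinner_commute cinner_hproj[OF H] hproj_in[OF H])
      thus "cinner y (blinfun_apply (adj T) x)
          = cinner y (blinfun_apply (hproj H) (blinfun_apply (adj T) x))"
        by (metis cinner_adj_right T' cinner_hproj[OF H] hproj_in[OF H])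
    qed simp_all
    thus ?thesis by (metis hproj_in[OF H])
  qed
  moreover have "blinfun_apply (adj T) x = 0" if "\<forall>h\<in>K. cinner h x = 0" for x
    by (rule cinner_eqI[OF hilbert_subspace_UNIV])
      (use that bopD[OF T] in \<open>simp_all add: cinner_adj_right cinner_commute[of _ x] cinner.zero_right\<close>)
  ultimately show ?thesis
    using cinner_adj(2)[OF T'(1)] by (auto simp: bop_def complex_linear_def)
qed

lemma csubspace_bop:
  assumes "hilbert_subspace K"
  shows "csubspace (bop H K)"
  by (rule complex_vector.subspaceI)
    (use hilbert_subspaceD[OF assms] in \<open>auto simp: bop_def blinfun.add_left scaleC_add_right
        image_subset_iff scaleC_scaleC mult.commute complex_vector.scale_zero_right\<close>)

text \<open>Each clause of \<open>bop\<close> restricts values at fixed vectors to a closed set, and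
  evaluation is continuous in norm. Norm-convergent sums of slices thus remain operators between the
  same spaces.\<close>

lemma closed_bop:
  assumes "hilbert_subspace K"
  shows "closed (bop H K)"
proof -
  have *: "closed {T :: 'a \<Rightarrow>\<^sub>L 'a. blinfun_apply T x \<in> M}" if "closed M" for M :: "'a set" and x
    using continuous_closed_vimage[OF that, of "\<lambda>T. blinfun_apply T x"]
    by (simp add: vimage_def blinfun.bounded_linear_left linear_continuous_at)
  have "closed {T :: 'a \<Rightarrow>\<^sub>L 'a. blinfun_apply T (a *\<^sub>C x) = a *\<^sub>C blinfun_apply T x}"
    for a and x :: 'a
    by (intro closed_Collect_eq)
      (intro linear_continuous_on blinfun.bounded_linear_left
        bounded_linear_compose[OF bounded_linear_scaleC blinfun.bounded_linear_left])+
  moreover have "closed {T :: 'a \<Rightarrow>\<^sub>L 'a. range (blinfun_apply T) \<subseteq> K}"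
    using assms unfolding image_subset_iff hilbert_subspace_def
    by (auto intro!: closed_Collect_all *)
  moreover have "closed {T :: 'a \<Rightarrow>\<^sub>L 'a. (\<forall>h\<in>H. cinner h x = 0) \<longrightarrow> blinfun_apply T x = 0}"
    for x
    using *[of "{0}" x] by (intro closed_Collect_imp open_Collect_const) simp
  ultimately show ?thesis
    unfolding bop_def by (intro closed_Collect_conj closed_Collect_all)
qed

lemma bop_eqI:
  assumes H: "hilbert_subspace H" and K: "hilbert_subspace K"
    and S: "S \<in> bop H K" and T: "T \<in> bop H K"
    and eq: "\<And>x y. x \<in> H \<Longrightarrow> y \<in> K \<Longrightarrow>
      cinner y (blinfun_apply S x) = cinner y (blinfun_apply T x)"
  shows "S = T"
proof (rule blinfun_eqI)
  fix x
  have "blinfun_apply S (blinfun_apply (hproj H) x) = blinfun_apply T (blinfun_apply (hproj H) x)"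
    by (rule cinner_eqI[OF K]) (use S T bopD in \<open>auto intro: eq hproj_in[OF H]\<close>)
  thus "blinfun_apply S x = blinfun_apply T x"
    using S T by (simp add: bop_iff[OF H])
qed


section \<open>Tensor products and slices\<close>

locale tensor_product =
  fixes H K T :: "'h::complex_hilbert set" and t :: "'h \<Rightarrow> 'h \<Rightarrow> 'h"
  assumes H: "hilbert_subspace H" and K: "hilbert_subspace K" and T: "hilbert_subspace T"
    and tensor: "hilbert_tensor H K T t"
begin

lemma tensor_in: "x \<in> H \<Longrightarrow> y \<in> K \<Longrightarrow> t x y \<in> T"
  using tensor by (auto simp: hilbert_tensor_def)

lemma tensor_add_left: "x \<in> H \<Longrightarrow> x' \<in> H \<Longrightarrow> y \<in> K \<Longrightarrow> t (x + x') y = t x y + t x' y"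
  using tensor by (simp add: hilbert_tensor_def)

lemma tensor_add_right: "x \<in> H \<Longrightarrow> y \<in> K \<Longrightarrow> y' \<in> K \<Longrightarrow> t x (y + y') = t x y + t x y'"
  using tensor by (simp add: hilbert_tensor_def)

lemma tensor_scale_left: "x \<in> H \<Longrightarrow> y \<in> K \<Longrightarrow> t (a *\<^sub>C x) y = a *\<^sub>C t x y"
  using tensor by (simp add: hilbert_tensor_def)

lemma tensor_scale_right: "x \<in> H \<Longrightarrow> y \<in> K \<Longrightarrow> t x (a *\<^sub>C y) = a *\<^sub>C t x y"
  using tensor by (simp add: hilbert_tensor_def)

lemma cinner_tensor: "x \<in> H \<Longrightarrow> x' \<in> H \<Longrightarrow> y \<in> K \<Longrightarrow> y' \<in> K \<Longrightarrow>
    cinner (t x y) (t x' y') = cinner x x' * cinner y y'"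
  using tensor by (simp add: hilbert_tensor_def)

lemma closed_cspan_tensors: "closed_cspan {t x y | x y. x \<in> H \<and> y \<in> K} = T"
  using tensor by (simp add: hilbert_tensor_def)

lemma tensor_zero_left: "y \<in> K \<Longrightarrow> t 0 y = 0"
  using tensor_scale_left[of 0 y 0] hilbert_subspaceD(1)[OF H]
  by (simp add: complex_vector.scale_zero_left)

lemma norm_tensor:
  assumes "x \<in> H" "y \<in> K"
  shows "norm (t x y) = norm x * norm y"
proof -
  have "complex_of_real ((norm (t x y))\<^sup>2) = complex_of_real ((norm x * norm y)\<^sup>2)"
    using cinner_tensor[of x x y y] assms by (simp add: cinner_self power_mult_distrib)
  thus ?thesis
    by (subst (asm) of_real_eq_iff) (simp add: power2_eq_iff_nonneg)
qed

text \<open>With this, whatever is built for slicing off the second factor also serves for the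
  first, which is what \<open>matrix_coefficient\<close> does.\<close>

lemma tensor_product_swap: "tensor_product K H T (\<lambda>y x. t x y)"
proof -
  have "{t x y | x y. x \<in> H \<and> y \<in> K} = {t x y | y x. y \<in> K \<and> x \<in> H}" by blast
  with tensor have "hilbert_tensor K H T (\<lambda>y x. t x y)"
    unfolding hilbert_tensor_def by (simp add: mult.commute)
  thus ?thesis
    by (intro tensor_product.intro H K T)
qed

lemma eq_on_tensors:
  assumes "\<xi> \<in> T" "\<eta> \<in> T"
    and eq: "\<And>x y. x \<in> H \<Longrightarrow> y \<in> K \<Longrightarrow> cinner (t x y) \<xi> = cinner (t x y) \<eta>"
  shows "\<xi> = \<eta>"
proof -
  have 0: "cinner (\<xi> - \<eta>) \<zeta> \<in> {0}" if "\<zeta> \<in> T" for \<zeta>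
  proof (rule closed_cspan_induct[where f = "cinner (\<xi> - \<eta>)"])
    show "\<zeta> \<in> closed_cspan {t x y | x y. x \<in> H \<and> y \<in> K}"
      using that closed_cspan_tensors by simp
    show "\<exists>b. cinner (\<xi> - \<eta>) (a *\<^sub>C x) = b *\<^sub>C cinner (\<xi> - \<eta>) x" for a x
      by (auto simp: cinner_scaleC_right scaleC_complex_def)
    show "cinner (\<xi> - \<eta>) x \<in> {0}" if "x \<in> {t x y | x y. x \<in> H \<and> y \<in> K}" for x
      using that eq by (auto simp: cinner_commute[of _ "t _ _"] cinner.diff_right)
  qed (auto intro: cinner.bounded_linear_right complex_vector.subspace_single_0)
  have "cinner (\<xi> - \<eta>) (\<xi> - \<eta>) = 0"
    using 0[OF hilbert_subspaceD(3)[OF T assms(1,2)]] by simp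
  thus ?thesis by (simp add: cinner_self)
qed

text \<open>The creation operator x \<mapsto> x \<otimes> v. Projecting x realises the extension by
  zero required by \<open>bop\<close>; projecting v makes this a bounded operator for every v of the
  ambient space, so that slices are linear or antilinear in their vectors without side
  conditions.\<close>

definition tensor_right :: "'h \<Rightarrow> 'h \<Rightarrow>\<^sub>L 'h"
  where "tensor_right v =
    Blinfun (\<lambda>x. t (blinfun_apply (hproj H) x) (blinfun_apply (hproj K) v))"

lemma tensor_right_apply:
  "blinfun_apply (tensor_right v) x = t (blinfun_apply (hproj H) x) (blinfun_apply (hproj K) v)"
proof -
  have complex_linear: "complex_linear (hproj H)" by (rule complex_linear_hproj[OF H])
  have "bounded_linear (\<lambda>x. t (blinfun_apply (hproj H) x) (blinfun_apply (hproj K) v))"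
  proof (rule bounded_linear_intro)
    show "t (blinfun_apply (hproj H) (r *\<^sub>R x)) (blinfun_apply (hproj K) v) =
        r *\<^sub>R t (blinfun_apply (hproj H) x) (blinfun_apply (hproj K) v)" for r x
      using tensor_scale_left[OF hproj_in[OF H] hproj_in[OF K], of "complex_of_real r" x v]
      by (simp add: scaleC_of_real blinfun.scaleR_right)
    show "norm (t (blinfun_apply (hproj H) x) (blinfun_apply (hproj K) v)) \<le> norm x * norm v" for x
      by (simp add: norm_tensor hproj_in H K norm_hproj_le mult_mono)
  qed (simp add: blinfun.add_right tensor_add_left hproj_in H K)
  thus ?thesis
    unfolding tensor_right_def by (simp add: bounded_linear_Blinfun_apply)
qed

lemma tensor_right_simp:
  "x \<in> H \<Longrightarrow> v \<in> K \<Longrightarrow> blinfun_apply (tensor_right v) x = t x v"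
  by (simp add: tensor_right_apply hproj_ident H K)

lemma tensor_right_bop: "tensor_right v \<in> bop H T"
  using complex_linear_hproj[OF H]
  by (simp add: bop_iff[OF H] tensor_right_apply complex_linear_def hproj_ident[OF H] hproj_in H K
      tensor_in tensor_scale_left)

lemma norm_tensor_right_le: "norm (tensor_right v) \<le> norm v"
  by (rule norm_blinfun_bound)
    (simp_all add: tensor_right_apply norm_tensor hproj_in H K norm_hproj_le mult_mono mult.commute)

lemma adj_tensor_right_tensor:
  assumes "x \<in> H" "y \<in> K" "v \<in> K"
  shows "blinfun_apply (adj (tensor_right v)) (t x y) = cinner v y *\<^sub>C x"
proof (rule cinner_eqI[OF H])
  show "blinfun_apply (adj (tensor_right v)) (t x y) \<in> H"
    by (rule bopD[OF bop_adj[OF H tensor_right_bop]])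
  show "cinner h (blinfun_apply (adj (tensor_right v)) (t x y)) = cinner h (cinner v y *\<^sub>C x)"
    if "h \<in> H" for h
    using that assms
    by (simp add: cinner_adj_right[OF bopD(1)[OF tensor_right_bop]] tensor_right_simp
        cinner_tensor cinner_scaleC_right)
qed (simp add: assms hilbert_subspaceD[OF H])

text \<open>Orthogonalising the left legs turns the norm of a sum of elementary tensors into
  a sum of squares, on which \<open>1 \<otimes> D\<close> visibly acts with norm at most that of \<open>D\<close>.\<close>

lemma orthogonal_representation:
  assumes "\<zeta> \<in> cspan {t x y | x y. x \<in> H \<and> y \<in> K}"
  shows "\<exists>(n::nat) e z. (\<forall>i<n. e i \<in> H \<and> z i \<in> K) \<and>
    (\<forall>i<n. \<forall>j<n. i \<noteq> j \<longrightarrow> cinner (e i) (e j) = 0) \<and> \<zeta> = (\<Sum>i<n. t (e i) (z i))"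
  using assms
proof (induction rule: complex_vector.span_induct_alt)
  case base
  show ?case by (intro exI[of _ 0]) simp
next
  case (step a w \<zeta>)
  then obtain x y where w: "w = t x y" "x \<in> H" "y \<in> K" by blast
  from step obtain n :: nat and e z where ez: "\<And>i. i < n \<Longrightarrow> e i \<in> H" "\<And>i. i < n \<Longrightarrow> z i \<in> K"
    and orth: "\<And>i j. i < n \<Longrightarrow> j < n \<Longrightarrow> i \<noteq> j \<Longrightarrow> cinner (e i) (e j) = 0"
    and \<zeta>: "\<zeta> = (\<Sum>i<n. t (e i) (z i))"
    by blast
  \<comment> \<open>Gram-Schmidt coefficients of \<open>a *\<^sub>C x\<close> against the orthogonal
    legs. Some \<open>e i\<close> may be 0; the quotient is then 0 and harmless.\<close>
  define q where "q i = cinner (e i) (a *\<^sub>C x) / cinner (e i) (e i)" for i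
  have sum_in: "(\<Sum>i<m. q i *\<^sub>C e i) \<in> H" if "m \<le> n" for m
    using H ez that unfolding hilbert_subspace_def
    by (auto intro!: complex_vector.subspace_sum complex_vector.subspace_scale)
  have tensor_sum: "t (\<Sum>i<m. q i *\<^sub>C e i) y = (\<Sum>i<m. t (e i) (q i *\<^sub>C y))" if "m \<le> n" for m
    using that
  proof (induction m)
    case (Suc m)
    then show ?case
      using ez w by (simp add: tensor_add_left sum_in hilbert_subspaceD[OF H]
          tensor_scale_left tensor_scale_right)
  qed (simp add: tensor_zero_left w)
  define r where "r = a *\<^sub>C x - (\<Sum>i<n. q i *\<^sub>C e i)"
  have r: "r \<in> H"
    using w sum_in by (auto simp: r_def intro!: hilbert_subspaceD[OF H])
  have er: "cinner (e i) r = 0" if "i < n" for i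
  proof -
    have "cinner (e i) (\<Sum>j<n. q j *\<^sub>C e j) = (\<Sum>j<n. q j * cinner (e i) (e j))"
      by (simp add: cinner.sum_right cinner_scaleC_right)
    also have "\<dots> = (\<Sum>j<n. if j = i then q i * cinner (e i) (e i) else 0)"
      by (rule sum.cong) (use orth that in auto)
    also have "\<dots> = q i * cinner (e i) (e i)"
      using that by simp
    also have "\<dots> = cinner (e i) (a *\<^sub>C x)"
      by (cases "e i = 0") (simp_all add: q_def cinner.zero_left cinner_self)
    finally show ?thesis by (simp add: r_def cinner.diff_right)
  qed
  have re: "cinner r (e i) = 0" if "i < n" for i
    using er[OF that] cinner_commute[of r "e i"] by simp
  define e' where "e' = e(n := r)"
  \<comment> \<open>The part of the new left leg along \<open>e i\<close> is moved to the right leg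
    \<open>z i\<close>; only the remainder \<open>r\<close>, orthogonal to all \<open>e i\<close>,
    needs a new summand, with right leg \<open>y\<close>.\<close>
  define z' where "z' i = (if i < n then z i + q i *\<^sub>C y else y)" for i
  have "a *\<^sub>C w = t (r + (\<Sum>i<n. q i *\<^sub>C e i)) y"
    by (simp add: w tensor_scale_left r_def)
  also have "\<dots> = t r y + (\<Sum>i<n. t (e i) (q i *\<^sub>C y))"
    by (simp add: tensor_add_left r sum_in w tensor_sum)
  also have "\<dots> + \<zeta> = t r y + (\<Sum>i<n. t (e i) (z i + q i *\<^sub>C y))"
    by (simp add: \<zeta> tensor_add_right ez w hilbert_subspaceD[OF K] sum.distrib)
  also have "\<dots> = (\<Sum>i<Suc n. t (e' i) (z' i))"
    by (simp add: e'_def z'_def)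
  finally have "a *\<^sub>C w + \<zeta> = (\<Sum>i<Suc n. t (e' i) (z' i))" .
  moreover have "\<forall>i<Suc n. e' i \<in> H \<and> z' i \<in> K"
    using ez w r by (auto simp: e'_def z'_def less_Suc_eq intro!: hilbert_subspaceD[OF K])
  moreover have "\<forall>i<Suc n. \<forall>j<Suc n. i \<noteq> j \<longrightarrow> cinner (e' i) (e' j) = 0"
    using orth er re by (auto simp: e'_def less_Suc_eq)
  ultimately show ?case by blast
qed

lemma norm_orthogonal_sum:
  assumes "\<And>i. i < n \<Longrightarrow> e i \<in> H" "\<And>i. i < n \<Longrightarrow> z i \<in> K"
    and "\<And>i j. i < n \<Longrightarrow> j < n \<Longrightarrow> i \<noteq> j \<Longrightarrow> cinner (e i) (e j) = 0"
  shows "(norm (\<Sum>i<n. t (e i) (z i)))\<^sup>2 = (\<Sum>i<n::nat. (norm (e i))\<^sup>2 * (norm (z i))\<^sup>2)"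
proof -
  have "(norm (\<Sum>i<n. t (e i) (z i)))\<^sup>2 = (\<Sum>i<n. (norm (t (e i) (z i)))\<^sup>2)"
  proof (rule norm_sum_Pythagorean)
    show "pairwise (\<lambda>i j. orthogonal (t (e i) (z i)) (t (e j) (z j))) {..<n}"
      using assms by (auto simp: pairwise_def orthogonal_def inner_eq_Re_cinner cinner_tensor)
  qed simp
  thus ?thesis
    by (simp add: norm_tensor assms power_mult_distrib)
qed

text \<open>\<open>G\<close> may be any operator that agrees with 1 \<otimes> D on elementary
  tensors. The bound is compared term by term on orthogonal sums, extends to \<open>T\<close> by
  closedness, and extends to the ambient space because \<open>G\<close> absorbs the projection onto
  \<open>T\<close>.\<close>

lemma norm_amplification_le:
  assumes G: "G \<in> bop T T" and D: "D \<in> bop K K"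
    and GD: "\<And>x y. x \<in> H \<Longrightarrow> y \<in> K \<Longrightarrow> blinfun_apply G (t x y) = t x (blinfun_apply D y)"
  shows "norm G \<le> norm D"
proof -
  have "cspan {t x y | x y. x \<in> H \<and> y \<in> K} \<subseteq> {\<zeta>. norm (blinfun_apply G \<zeta>) \<le> norm D * norm \<zeta>}"
  proof (intro subsetI CollectI)
    fix \<zeta> assume "\<zeta> \<in> cspan {t x y | x y. x \<in> H \<and> y \<in> K}"
    then obtain n :: nat and e z where ez: "\<And>i. i < n \<Longrightarrow> e i \<in> H" "\<And>i. i < n \<Longrightarrow> z i \<in> K"
      and orth: "\<And>i j. i < n \<Longrightarrow> j < n \<Longrightarrow> i \<noteq> j \<Longrightarrow> cinner (e i) (e j) = 0"
      and \<zeta>: "\<zeta> = (\<Sum>i<n. t (e i) (z i))"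
      using orthogonal_representation[of \<zeta>] by blast
    have "(norm (blinfun_apply G \<zeta>))\<^sup>2 = (norm (\<Sum>i<n. t (e i) (blinfun_apply D (z i))))\<^sup>2"
      by (simp add: \<zeta> blinfun.sum_right GD ez)
    also have "\<dots> = (\<Sum>i<n. (norm (e i))\<^sup>2 * (norm (blinfun_apply D (z i)))\<^sup>2)"
      by (rule norm_orthogonal_sum) (auto simp: ez orth bopD[OF D])
    also have "\<dots> \<le> (\<Sum>i<n. (norm (e i))\<^sup>2 * ((norm D * norm (z i))\<^sup>2))"
      by (intro sum_mono mult_left_mono power_mono norm_blinfun) auto
    also have "\<dots> = (norm D)\<^sup>2 * (\<Sum>i<n. (norm (e i))\<^sup>2 * (norm (z i))\<^sup>2)"
      by (simp add: sum_distrib_left power_mult_distrib ac_simps)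
    also have "\<dots> = (norm D * norm \<zeta>)\<^sup>2"
      using norm_orthogonal_sum[of n e z] ez orth by (simp add: \<zeta> power_mult_distrib)
    finally show "norm (blinfun_apply G \<zeta>) \<le> norm D * norm \<zeta>"
      by (rule power2_le_imp_le) simp
  qed
  moreover have "closed {\<zeta>. norm (blinfun_apply G \<zeta>) \<le> norm D * norm \<zeta>}"
    by (intro closed_Collect_le continuous_intros)
  ultimately have "T \<subseteq> {\<zeta>. norm (blinfun_apply G \<zeta>) \<le> norm D * norm \<zeta>}"
    using closed_cspan_tensors closure_minimal unfolding closed_cspan_def by blast
  hence *: "norm (blinfun_apply G (blinfun_apply (hproj T) \<zeta>))
      \<le> norm D * norm (blinfun_apply (hproj T) \<zeta>)" for \<zeta>
    using hproj_in[OF T] by blast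
  show ?thesis
  proof (rule norm_blinfun_bound)
    fix \<zeta>
    show "norm (blinfun_apply G \<zeta>) \<le> norm D * norm \<zeta>"
      using *[of \<zeta>] G mult_left_mono[OF norm_hproj_le[OF T], of "norm D" \<zeta>]
      by (simp add: bop_iff[OF T])
  qed simp
qed

end

section \<open>Slices of operators between tensor products\<close>

locale two_tensor_products =
  dom: tensor_product H K T t + cod: tensor_product H' K' T' t'
  for H K T H' K' T' :: "'h::complex_hilbert set" and t t'
begin

text \<open>The slice by the functional b \<mapsto> <u, b v>, written as creation by v, then A, then
  the adjoint of creation by u. Unlike \<open>slice\<close> this is an explicit composite, so
  products of slices can be rearranged directly.\<close>

definition vector_slice :: "('h \<Rightarrow>\<^sub>L 'h) \<Rightarrow> 'h \<Rightarrow> 'h \<Rightarrow> ('h \<Rightarrow>\<^sub>L 'h)"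
  where "vector_slice A u v = adj (cod.tensor_right u) o\<^sub>L A o\<^sub>L dom.tensor_right v"

lemma vector_slice_add: "vector_slice (A + B) u v = vector_slice A u v + vector_slice B u v"
  unfolding vector_slice_def by (intro blinfun_eqI) (simp add: blinfun.add_left blinfun.add_right)

lemma vector_slice_diff: "vector_slice (A - B) u v = vector_slice A u v - vector_slice B u v"
  unfolding vector_slice_def by (intro blinfun_eqI) (simp add: blinfun.diff_left blinfun.diff_right)

lemma vector_slice_scale: "vector_slice (a *\<^sub>C A) u v = a *\<^sub>C vector_slice A u v"
  using cinner_adj(2)[OF bopD(1)[OF cod.tensor_right_bop[of u]]]
  unfolding vector_slice_def by (intro blinfun_eqI) (simp add: complex_linear_def)

context
  fixes A assumes A: "A \<in> bop T T'"
begin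

lemma vector_slice_bop: "vector_slice A u v \<in> bop H H'"
  unfolding vector_slice_def
  by (intro bop_compose[OF bop_compose[OF bop_adj A]] cod.H cod.tensor_right_bop dom.tensor_right_bop)

lemma cinner_vector_slice:
  assumes "x \<in> H" "x' \<in> H'" "u \<in> K'" "v \<in> K"
  shows "cinner x' (blinfun_apply (vector_slice A u v) x) =
    cinner (t' x' u) (blinfun_apply A (t x v))"
  using bopD(1)[OF cod.tensor_right_bop] assms
  by (simp add: vector_slice_def cinner_adj_right cod.tensor_right_simp dom.tensor_right_simp)

lemma norm_vector_slice_le: "norm (vector_slice A u v) \<le> norm u * norm A * norm v"
proof -
  have "norm (vector_slice A u v) \<le> norm (adj (cod.tensor_right u) o\<^sub>L A) * norm (dom.tensor_right v)"
    unfolding vector_slice_def by (rule norm_blinfun_compose)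
  also have "\<dots> \<le> (norm (adj (cod.tensor_right u)) * norm A) * norm v"
    by (intro mult_mono norm_blinfun_compose dom.norm_tensor_right_le) auto
  also have "\<dots> \<le> (norm u * norm A) * norm v"
    using norm_adj_le[OF bopD(1)[OF cod.tensor_right_bop[of u]]] cod.norm_tensor_right_le[of u]
    by (intro mult_right_mono) auto
  finally show ?thesis .
qed

lemma cinner_vector_slice_hproj:
  assumes "x \<in> H" "x' \<in> H'"
  shows "cinner x' (blinfun_apply (vector_slice A u v) x) =
    cinner (t' x' (blinfun_apply (hproj K') u)) (blinfun_apply A (t x (blinfun_apply (hproj K) v)))"
  using bopD(1)[OF cod.tensor_right_bop] assms
  by (simp add: vector_slice_def cinner_adj_right cod.tensor_right_apply dom.tensor_right_apply
      hproj_ident cod.H dom.H)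

lemma vector_slice_eqI:
  assumes "S \<in> bop H H'"
    and "\<And>x x'. x \<in> H \<Longrightarrow> x' \<in> H' \<Longrightarrow> cinner x' (blinfun_apply S x) =
      cinner x' (blinfun_apply (vector_slice A u v) x)"
  shows "vector_slice A u v = S"
  by (rule bop_eqI[OF dom.H cod.H vector_slice_bop assms(1)]) (simp add: assms(2))

lemma vector_slice_scale_right: "vector_slice A u (a *\<^sub>C v) = a *\<^sub>C vector_slice A u v"
  using complex_linear_hproj[OF dom.K] bopD(1)[OF A]
  by (intro vector_slice_eqI complex_vector.subspace_scale[OF csubspace_bop[OF cod.H]] vector_slice_bop)
    (simp add: cinner_vector_slice_hproj cinner_scaleC_right dom.tensor_scale_right hproj_in dom.K complex_linear_def)

lemma vector_slice_scale_left: "vector_slice A (a *\<^sub>C u) v = cnj a *\<^sub>C vector_slice A u v"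
  using complex_linear_hproj[OF cod.K]
  by (intro vector_slice_eqI complex_vector.subspace_scale[OF csubspace_bop[OF cod.H]] vector_slice_bop)
    (simp add: cinner_vector_slice_hproj cinner_scaleC_right cinner_scaleC_left
      cod.tensor_scale_right hproj_in cod.K complex_linear_def)

lemma bounded_linear_vector_slice_right: "bounded_linear (vector_slice A u)"
proof (rule bounded_linear_intro)
  show "vector_slice A u (v + w) = vector_slice A u v + vector_slice A u w" for v w
    by (intro vector_slice_eqI complex_vector.subspace_add[OF csubspace_bop[OF cod.H]] vector_slice_bop)
      (simp add: cinner_vector_slice_hproj cinner_add_right blinfun.add_left blinfun.add_right
        dom.tensor_add_right hproj_in dom.K)
  show "vector_slice A u (r *\<^sub>R v) = r *\<^sub>R vector_slice A u v" for r v
    using vector_slice_scale_right[of u "complex_of_real r" v] by (simp add: scaleC_of_real)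
  show "norm (vector_slice A u v) \<le> norm v * (norm u * norm A)" for v
    using norm_vector_slice_le[of u v] by (simp add: mult.commute)
qed

lemma bounded_linear_vector_slice_left: "bounded_linear (\<lambda>u. vector_slice A u v)"
proof (rule bounded_linear_intro)
  show "vector_slice A (u + w) v = vector_slice A u v + vector_slice A w v" for u w
    by (intro vector_slice_eqI complex_vector.subspace_add[OF csubspace_bop[OF cod.H]] vector_slice_bop)
      (simp add: cinner_vector_slice_hproj cinner_add_right cinner_add_left blinfun.add_left
        blinfun.add_right cod.tensor_add_right hproj_in cod.K)
  show "vector_slice A (r *\<^sub>R u) v = r *\<^sub>R vector_slice A u v" for r u
    using vector_slice_scale_left[of "complex_of_real r" u v] by (simp add: scaleC_of_real)
  show "norm (vector_slice A u v) \<le> norm u * (norm A * norm v)" for u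
    using norm_vector_slice_le[of u v] by (simp add: mult.assoc)
qed

text \<open>Slicing off the first leg is slicing off the second leg of the swapped products, so a
  vector slice there is the witness for the definite description. Uniqueness holds because matrix
  entries determine an operator.\<close>

lemma matrix_coefficient:
  assumes x: "x \<in> H" "x' \<in> H'"
  shows matrix_coefficient_bop: "matrix_coefficient K K' t t' A x' x \<in> bop K K'"
    and cinner_matrix_coefficient: "y \<in> K \<Longrightarrow> y' \<in> K' \<Longrightarrow>
      cinner y' (blinfun_apply (matrix_coefficient K K' t t' A x' x) y) =
      cinner (t' x' y') (blinfun_apply A (t x y))"
proof -
  interpret swap: two_tensor_products K H T K' H' T' "\<lambda>y x. t x y" "\<lambda>y x. t' x y"
    by (intro two_tensor_products.intro dom.tensor_product_swap cod.tensor_product_swap)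
  let ?P = "\<lambda>b. b \<in> bop K K' \<and> (\<forall>y\<in>K. \<forall>y'\<in>K'.
    cinner y' (blinfun_apply b y) = cinner (t' x' y') (blinfun_apply A (t x y)))"
  have "\<exists>!b. ?P b"
  proof (rule ex1I)
    have "swap.vector_slice A x' x \<in> bop K K'"
      unfolding swap.vector_slice_def
      by (intro bop_compose[OF bop_compose[OF bop_adj A]] swap.cod.H swap.cod.tensor_right_bop
          swap.dom.tensor_right_bop)
    moreover have "cinner y' (blinfun_apply (swap.vector_slice A x' x) y) =
        cinner (t' x' y') (blinfun_apply A (t x y))" if "y \<in> K" "y' \<in> K'" for y y'
      using bopD(1)[OF swap.cod.tensor_right_bop] x that
      by (simp add: swap.vector_slice_def cinner_adj_right swap.cod.tensor_right_simp
          swap.dom.tensor_right_simp)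
    ultimately show "?P (swap.vector_slice A x' x)" by blast
    show "b = swap.vector_slice A x' x" if "?P b" for b
      by (rule bop_eqI[OF dom.K cod.K])
        (use that \<open>?P (swap.vector_slice A x' x)\<close> in auto)
  qed
  from theI'[OF this] show "matrix_coefficient K K' t t' A x' x \<in> bop K K'"
    "y \<in> K \<Longrightarrow> y' \<in> K' \<Longrightarrow> cinner y' (blinfun_apply (matrix_coefficient K K' t t' A x' x) y) =
      cinner (t' x' y') (blinfun_apply A (t x y))"
    unfolding matrix_coefficient_def[symmetric] by blast+
qed

text \<open>The bound ab \<le> a^2 + b^2 makes the series of vector slices absolutely convergent in
  operator norm, not merely weakly. Its sum has the matrix entries that characterise
  \<open>slice\<close>.\<close>

lemma slice_eq_suminf:
  assumes y: "\<And>n::nat. y n \<in> K" "\<And>n. y' n \<in> K'"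
    and y2: "summable (\<lambda>n. (norm (y n))\<^sup>2)" and y'2: "summable (\<lambda>n. (norm (y' n))\<^sup>2)"
    and \<omega>: "\<omega> = (\<lambda>B. if B \<in> bop K K' then \<Sum>n. cinner (y' n) (blinfun_apply B (y n)) else 0)"
  shows "(\<lambda>n. vector_slice A (y' n) (y n)) sums slice H K H' K' t t' \<omega> A"
proof -
  have "summable (\<lambda>n. ((norm (y' n))\<^sup>2 + (norm (y n))\<^sup>2) * norm A)"
    by (intro summable_mult2 summable_add y2 y'2)
  hence summable: "summable (\<lambda>n. vector_slice A (y' n) (y n))"
  proof (rule summable_comparison_test'[where N = 0])
    fix n
    have "norm (y' n) * norm (y n) \<le> (norm (y' n))\<^sup>2 + (norm (y n))\<^sup>2"
      using sum_squares_bound[of "norm (y' n)" "norm (y n)"]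
        mult_nonneg_nonneg[OF norm_ge_zero[of "y' n"] norm_ge_zero[of "y n"]] by linarith
    hence "norm (y' n) * norm (y n) * norm A \<le> ((norm (y' n))\<^sup>2 + (norm (y n))\<^sup>2) * norm A"
      by (rule mult_right_mono) simp
    thus "norm (vector_slice A (y' n) (y n)) \<le> ((norm (y' n))\<^sup>2 + (norm (y n))\<^sup>2) * norm A"
      using norm_vector_slice_le[of "y' n" "y n"] by (simp add: ac_simps)
  qed
  define S where "S = (\<Sum>n. vector_slice A (y' n) (y n))"
  have sums: "(\<lambda>n. vector_slice A (y' n) (y n)) sums S"
    unfolding S_def by (rule summable_sums[OF summable])
  have "S \<in> bop H H'"
  proof (rule closed_sequentially[OF closed_bop[OF cod.H]])
    show "(\<lambda>n. \<Sum>i<n. vector_slice A (y' i) (y i)) \<longlonglongrightarrow> S"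
      using sums by (simp add: sums_def)
    show "(\<Sum>i<n. vector_slice A (y' i) (y i)) \<in> bop H H'" for n
      by (intro complex_vector.subspace_sum[OF csubspace_bop[OF cod.H]] vector_slice_bop)
  qed
  moreover have eq: "cinner x' (blinfun_apply S x) = \<omega> (matrix_coefficient K K' t t' A x' x)"
    if "x \<in> H" "x' \<in> H'" for x x'
  proof -
    have "(\<lambda>n. cinner x' (blinfun_apply (vector_slice A (y' n) (y n)) x)) sums
        cinner x' (blinfun_apply S x)"
      by (intro bounded_linear.sums[OF cinner.bounded_linear_right]
          bounded_linear.sums[OF blinfun.bounded_linear_left] sums)
    thus ?thesis
      using y that
      by (simp add: \<omega> matrix_coefficient_bop cinner_matrix_coefficient cinner_vector_slice sums_iff)
  qed
  ultimately have "slice H K H' K' t t' \<omega> A = S"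
    unfolding slice_def
    by (intro the_equality bop_eqI[OF dom.H cod.H]) auto
  with sums show ?thesis by simp
qed

text \<open>Norm convergence of the series puts every slice into the closed span of the vector
  slices. This is applied to F, for \<open>A_hat\<close>, and to c, for semi-regularity.\<close>

lemma closed_cspan_slices:
  "closed_cspan {slice H K H' K' t t' \<omega> A | \<omega>. \<omega> \<in> normal_functionals K K'} =
   closed_cspan {vector_slice A u v | u v. u \<in> K' \<and> v \<in> K}" (is "closed_cspan ?S = closed_cspan ?V")
proof
  show "closed_cspan ?S \<subseteq> closed_cspan ?V"
  proof (rule closed_cspan_minimal[OF _ csubspace_closed_cspan closed_closed_cspan])
    show "?S \<subseteq> closed_cspan ?V"
    proof clarify
      fix \<omega> assume "\<omega> \<in> normal_functionals K K'"
      then obtain y y' :: "nat \<Rightarrow> 'h" where y: "\<And>n. y n \<in> K" "\<And>n. y' n \<in> K'"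
        "summable (\<lambda>n. (norm (y n))\<^sup>2)" "summable (\<lambda>n. (norm (y' n))\<^sup>2)"
        "\<omega> = (\<lambda>B. if B \<in> bop K K' then \<Sum>n. cinner (y' n) (blinfun_apply B (y n)) else 0)"
        unfolding normal_functionals_def by blast
      show "slice H K H' K' t t' \<omega> A \<in> closed_cspan ?V"
      proof (rule closed_sequentially[OF closed_closed_cspan])
        show "(\<lambda>n. \<Sum>i<n. vector_slice A (y' i) (y i)) \<longlonglongrightarrow> slice H K H' K' t t' \<omega> A"
          using slice_eq_suminf[OF y] by (simp add: sums_def)
        show "(\<Sum>i<n. vector_slice A (y' i) (y i)) \<in> closed_cspan ?V" for n
          using y closed_cspan_superset[of ?V]
          by (intro complex_vector.subspace_sum[OF csubspace_closed_cspan]) blast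
      qed
    qed
  qed
  show "closed_cspan ?V \<subseteq> closed_cspan ?S"
  proof (rule closed_cspan_minimal[OF _ csubspace_closed_cspan closed_closed_cspan])
    show "?V \<subseteq> closed_cspan ?S"
    proof clarify
      fix u v assume uv: "u \<in> K'" "v \<in> K"
      \<comment> \<open>A vector functional is a normal functional whose two sequences are supported
        at index 0.\<close>
      define y where "y n = (if n = 0 then v else 0)" for n :: nat
      define y' where "y' n = (if n = 0 then u else 0)" for n :: nat
      define \<omega> where
        "\<omega> = (\<lambda>B. if B \<in> bop K K' then \<Sum>n. cinner (y' n) (blinfun_apply B (y n)) else 0)"
      have y: "y n \<in> K" "y' n \<in> K'" for n
        using uv hilbert_subspaceD(1) dom.K cod.K by (auto simp: y_def y'_def)
      have sq: "summable (\<lambda>n. (norm (y n))\<^sup>2)" "summable (\<lambda>n. (norm (y' n))\<^sup>2)"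
        by (rule summable_finite[of "{0}"]; simp add: y_def y'_def)+
      have "(\<lambda>n. vector_slice A (y' n) (y n)) sums (\<Sum>n\<in>{0}. vector_slice A (y' n) (y n))"
        by (rule sums_finite)
          (simp_all add: y_def bounded_linear.linear[THEN linear_0, OF bounded_linear_vector_slice_right])
      hence "slice H K H' K' t t' \<omega> A = vector_slice A u v"
        using sums_unique2[OF slice_eq_suminf[OF y sq \<omega>_def]] by (simp add: y_def y'_def)
      moreover have "\<omega> \<in> normal_functionals K K'"
        unfolding normal_functionals_def using y sq \<omega>_def by blast
      ultimately show "vector_slice A u v \<in> closed_cspan ?S"
        using closed_cspan_superset[of ?S] by force
    qed
  qed
qed

end

end


section \<open>Rank-one operators\<close>

lemma bounded_linear_scaleC_left: "bounded_linear (\<lambda>b. b *\<^sub>C (x::'a::complex_normed_vector))"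
  by (rule bounded_linear_intro[where K = "norm x"])
    (simp_all add: scaleC_add_left norm_scaleC scaleR_conv_of_real scaleC_of_real[symmetric])

definition rank_one :: "'h::complex_hilbert \<Rightarrow> 'h \<Rightarrow> 'h \<Rightarrow>\<^sub>L 'h"
  where "rank_one x y = Blinfun (\<lambda>z. cinner y z *\<^sub>C x)"

lemma rank_one_apply: "blinfun_apply (rank_one x y) z = cinner y z *\<^sub>C x"
  unfolding rank_one_def
  by (subst bounded_linear_Blinfun_apply)
    (intro bounded_linear_compose[OF bounded_linear_scaleC_left] cinner.bounded_linear_right refl)+

lemma rank_one_compact_ops:
  assumes K: "hilbert_subspace K" and "x \<in> K" "y \<in> H"
  shows "rank_one x y \<in> compact_ops H K"
proof -
  have bop: "rank_one x y \<in> bop H K"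
    using assms hilbert_subspaceD(4)[OF K]
    by (auto simp: bop_def rank_one_apply cinner_scaleC_right scaleC_scaleC
        complex_vector.scale_zero_left)
  \<comment> \<open>The multiples of x by a closed disc of scalars form a compact set; by
    Cauchy-Schwarz the radius \<open>norm y\<close> is enough for the image of the unit
    ball.\<close>
  let ?B = "(\<lambda>b. b *\<^sub>C x) ` cball 0 (norm y)"
  have cpt: "compact ?B"
    by (intro compact_continuous_image linear_continuous_on bounded_linear_scaleC_left compact_cball)
  have "blinfun_apply (rank_one x y) ` (H \<inter> cball 0 1) \<subseteq> ?B"
  proof clarify
    fix z :: 'a assume "z \<in> cball 0 1"
    hence "cmod (cinner y z) \<le> norm y"
      using norm_cinner_le[of y z] mult_left_mono[of "norm z" 1 "norm y"] by simp
    thus "blinfun_apply (rank_one x y) z \<in> ?B"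
      by (auto simp: rank_one_apply)
  qed
  hence "closure (blinfun_apply (rank_one x y) ` (H \<inter> cball 0 1)) \<subseteq> ?B"
    by (rule closure_minimal[OF _ compact_imp_closed[OF cpt]])
  hence "compact (closure (blinfun_apply (rank_one x y) ` (H \<inter> cball 0 1)))"
    using compact_Int_closed[OF cpt closed_closure] by (metis inf.absorb2)
  with bop show ?thesis by (simp add: compact_ops_def)
qed

lemma blinfun_compose_scaleC_right: "complex_linear S \<Longrightarrow> S o\<^sub>L (b *\<^sub>C T) = b *\<^sub>C (S o\<^sub>L T)"
  by (rule blinfun_eqI) (simp add: complex_linear_def)

lemma blinfun_compose_scaleC_left:
  "(b *\<^sub>C S) o\<^sub>L T = b *\<^sub>C (S o\<^sub>L T)" for S :: "'b::real_normed_vector \<Rightarrow>\<^sub>L 'c::complex_normed_vector"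
  by (rule blinfun_eqI) simp

section \<open>Braided multiplicative unitaries\<close>

context cstar_category
begin

lemma is_inverse_unique:
  assumes X: "X \<in> Ob C" "Y \<in> Ob C" and "is_inverse C X Y f g" "is_inverse C X Y f h"
  shows "g = h"
proof -
  have m: "f \<in> Hom C X Y" "g \<in> Hom C Y X" "h \<in> Hom C Y X"
    and e: "g \<cdot> f = \<iota> X" "f \<cdot> h = \<iota> Y"
    using assms by (auto simp: is_inverse_def)
  have "g = g \<cdot> (f \<cdot> h)"
    using Comp_Id[OF X(2,1) m(2)] e by simp
  also have "\<dots> = (g \<cdot> f) \<cdot> h"
    using Comp_assoc[OF X(2,1,2,1) m(3,1,2)] by simp
  also have "\<dots> = h"
    using Comp_Id[OF X(2,1) m(3)] e by simp
  finally show ?thesis .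
qed

lemma inv_mor_unitary:
  assumes "X \<in> Ob C" "Y \<in> Ob C" "unitary C X Y u"
  shows "inv_mor C X Y u = u\<dagger>"
proof -
  have "is_inverse C X Y u (u\<dagger>)"
    using assms Dag_in_Hom by (auto simp: unitary_def is_inverse_def)
  thus ?thesis
    unfolding inv_mor_def using is_inverse_unique[OF assms(1,2)] by blast
qed

lemma Dag_Id:
  assumes "X \<in> Ob C"
  shows "(\<iota> X)\<dagger> = \<iota> X"
  using Comp_Id[of X X "(\<iota> X)\<dagger>"] Dag_Comp[of X X X "(\<iota> X)\<dagger>" "\<iota> X"] Dag_Dag[of X X "\<iota> X"]
    Dag_in_Hom[of X X "\<iota> X"] Id_in_Hom[OF assms] assms by simp

end

context concrete_monoidal_wstar_category
begin

lemma Op_Comp_apply: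
  "\<lbrakk>X \<in> Ob C; Y \<in> Ob C; Z \<in> Ob C; f \<in> Hom C X Y; g \<in> Hom C Y Z\<rbrakk>
    \<Longrightarrow> blinfun_apply (Op C (g \<cdot> f)) x = blinfun_apply (Op C g) (blinfun_apply (Op C f) x)"
  by (simp add: Op_Comp)

lemma Op_in_Sp: "\<lbrakk>X \<in> Ob C; Y \<in> Ob C; f \<in> Hom C X Y\<rbrakk> \<Longrightarrow> blinfun_apply (Op C f) x \<in> Sp C Y"
  by (rule bopD(2)[OF Op_in_bop])

text \<open>\<open>Op C (\<iota> Y)\<close> is the projection onto \<open>Sp C Y\<close>, not the
  identity of the ambient space. Cancelling inverses therefore leaves a projection behind, which the
  neighbouring operator absorbs by this rule and the next.\<close>

lemma Op_Id_Op:
  "\<lbrakk>X \<in> Ob C; Y \<in> Ob C; f \<in> Hom C X Y\<rbrakk> \<Longrightarrow>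
    blinfun_apply (Op C (\<iota> Y)) (blinfun_apply (Op C f) x) = blinfun_apply (Op C f) x"
  by (simp add: Op_Id Op_in_Sp)

lemma Op_Op_Id:
  assumes "X \<in> Ob C" "Y \<in> Ob C" "f \<in> Hom C X Y"
  shows "blinfun_apply (Op C f) (blinfun_apply (Op C (\<iota> X)) x) = blinfun_apply (Op C f) x"
  using Op_Comp_apply[OF assms(1,1,2) Id_in_Hom[OF assms(1)] assms(3), of x] Comp_Id[OF assms]
  by simp

lemma tensor_product_Tv:
  "\<lbrakk>X \<in> Ob C; Y \<in> Ob C\<rbrakk> \<Longrightarrow> tensor_product (Sp C X) (Sp C Y) (Sp C (X \<odot> Y)) (Tv C X Y)"
  by (intro tensor_product.intro Sp_hilbert TenO_in_Ob Tv_tensor)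

end

locale braided_multiplicative_unitary =
  concrete_monoidal_wstar_category C + braiding C c
  for C :: "('o, 'm::{complex_normed_vector, banach}, 'h::complex_hilbert, 'x)
      concrete_data_scheme" (structure)
    and c :: "'o \<Rightarrow> 'o \<Rightarrow> 'm" +
  fixes L :: 'o and F :: 'm
  assumes semi_regular: "semi_regular C c" and L: "L \<in> Ob C"
    and multiplicative: "multiplicative_unitary C c L F"
begin

section \<open>The equations on the threefold tensor product, as operator identities\<close>

abbreviation "LL \<equiv> L \<odot> L"
abbreviation "asc \<equiv> \<alpha> L L L"
abbreviation "cL \<equiv> c L L"

lemma LL: "LL \<in> Ob C" and LL_L: "LL \<odot> L \<in> Ob C" and L_LL: "L \<odot> LL \<in> Ob C"
  by (simp_all add: L TenO_in_Ob)

lemma F_unitary: "unitary C LL LL F"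
  using multiplicative by (simp add: multiplicative_unitary_def)

lemma c_unitary: "X \<in> Ob C \<Longrightarrow> Y \<in> Ob C \<Longrightarrow> unitary C (X \<odot> Y) (Y \<odot> X) (c X Y)"
  using semi_regular by (simp add: semi_regular_def)

lemma homs [simp]:
  "F \<in> Hom C LL LL" "cL \<in> Hom C LL LL" "asc \<in> Hom C (LL \<odot> L) (L \<odot> LL)"
  "c LL L \<in> Hom C (LL \<odot> L) (L \<odot> LL)" "\<iota> L \<in> Hom C L L"
  using F_unitary c_unitary[OF L L] c_unitary[OF LL L] Assoc_unitary[OF L L L] Id_in_Hom[OF L]
  by (simp_all add: unitary_def)

lemmas obs [simp] = L LL LL_L L_LL

lemma Dag_homs [simp]:
  "F\<dagger> \<in> Hom C LL LL" "cL\<dagger> \<in> Hom C LL LL" "asc\<dagger> \<in> Hom C (L \<odot> LL) (LL \<odot> L)"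
  by (simp_all add: Dag_in_Hom)

lemma TenM_homs [simp]:
  "g \<in> Hom C LL LL \<Longrightarrow> g \<otimes> \<iota> L \<in> Hom C (LL \<odot> L) (LL \<odot> L)"
  "g \<in> Hom C LL LL \<Longrightarrow> \<iota> L \<otimes> g \<in> Hom C (L \<odot> LL) (L \<odot> LL)"
  by (simp_all add: TenM_in_Hom)

lemma inv_a: "inv_mor C (LL \<odot> L) (L \<odot> LL) asc = asc\<dagger>"
  by (rule inv_mor_unitary) (simp_all add: Assoc_unitary)

lemma inv_c: "inv_mor C LL LL cL = cL\<dagger>"
  by (rule inv_mor_unitary) (simp_all add: c_unitary)

text \<open>The operators named \<open>F_id\<close>, \<open>c_id\<close> and \<open>cdag_id\<close>
  act on (L \<odot> L) \<odot> L, those named \<open>id_F\<close>, \<open>id_Fdag\<close> and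
  \<open>id_c\<close> on L \<odot> (L \<odot> L). An operator on legs two and three of the first
  bracketing is thus the latter conjugated by \<open>assoc\<close>; \<open>c_LL\<close> goes from
  the first bracketing to the second.\<close>

definition F_id where "F_id = Op C (F \<otimes> \<iota> L)"
definition id_F where "id_F = Op C (\<iota> L \<otimes> F)"
definition id_Fdag where "id_Fdag = Op C (\<iota> L \<otimes> F\<dagger>)"
definition c_id where "c_id = Op C (cL \<otimes> \<iota> L)"
definition cdag_id where "cdag_id = Op C (cL\<dagger> \<otimes> \<iota> L)"
definition id_c where "id_c = Op C (\<iota> L \<otimes> cL)"
definition assoc where "assoc = Op C asc"
definition assoc_dag where "assoc_dag = Op C (asc\<dagger>)"
definition c_LL where "c_LL = Op C (c LL L)"

lemmas op_defs =
  F_id_def id_F_def id_Fdag_def c_id_def cdag_id_def id_c_def assoc_def assoc_dag_def c_LL_def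

text \<open>A composite does not reveal the object through which it passes, so the rules are fixed
  for all eight triples of the two bracketings.\<close>

lemmas comp_simps =
  Comp_in_Hom[where X = "LL \<odot> L" and Y = "LL \<odot> L" and Z = "LL \<odot> L"]
  Comp_in_Hom[where X = "LL \<odot> L" and Y = "LL \<odot> L" and Z = "L \<odot> LL"]
  Comp_in_Hom[where X = "LL \<odot> L" and Y = "L \<odot> LL" and Z = "LL \<odot> L"]
  Comp_in_Hom[where X = "LL \<odot> L" and Y = "L \<odot> LL" and Z = "L \<odot> LL"]
  Comp_in_Hom[where X = "L \<odot> LL" and Y = "LL \<odot> L" and Z = "LL \<odot> L"]
  Comp_in_Hom[where X = "L \<odot> LL" and Y = "LL \<odot> L" and Z = "L \<odot> LL"]
  Comp_in_Hom[where X = "L \<odot> LL" and Y = "L \<odot> LL" and Z = "LL \<odot> L"]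
  Comp_in_Hom[where X = "L \<odot> LL" and Y = "L \<odot> LL" and Z = "L \<odot> LL"]
  Op_Comp_apply[where X = "LL \<odot> L" and Y = "LL \<odot> L" and Z = "LL \<odot> L"]
  Op_Comp_apply[where X = "LL \<odot> L" and Y = "LL \<odot> L" and Z = "L \<odot> LL"]
  Op_Comp_apply[where X = "LL \<odot> L" and Y = "L \<odot> LL" and Z = "LL \<odot> L"]
  Op_Comp_apply[where X = "LL \<odot> L" and Y = "L \<odot> LL" and Z = "L \<odot> LL"]
  Op_Comp_apply[where X = "L \<odot> LL" and Y = "LL \<odot> L" and Z = "LL \<odot> L"]
  Op_Comp_apply[where X = "L \<odot> LL" and Y = "LL \<odot> L" and Z = "L \<odot> LL"]
  Op_Comp_apply[where X = "L \<odot> LL" and Y = "L \<odot> LL" and Z = "LL \<odot> L"]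
  Op_Comp_apply[where X = "L \<odot> LL" and Y = "L \<odot> LL" and Z = "L \<odot> LL"]

lemma pentagon_Op:
  "assoc_dag (id_F (assoc (F_id x))) =
    F_id (cdag_id (assoc_dag (id_F (assoc (c_id (assoc_dag (id_F (assoc x))))))))"
proof -
  have "asc\<dagger> \<cdot> (\<iota> L \<otimes> F) \<cdot> asc \<cdot> (F \<otimes> \<iota> L) = (F \<otimes> \<iota> L) \<cdot> (cL\<dagger> \<otimes> \<iota> L) \<cdot> (asc\<dagger> \<cdot> (\<iota> L \<otimes> F) \<cdot> asc) \<cdot>
      (cL \<otimes> \<iota> L) \<cdot> (asc\<dagger> \<cdot> (\<iota> L \<otimes> F) \<cdot> asc)"
    using multiplicative
    by (simp add: multiplicative_unitary_def leg12_def leg23_def inv_a inv_c)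
  from arg_cong[OF this, of "\<lambda>f. blinfun_apply (Op C f) x"] show ?thesis
    by (simp add: comp_simps op_defs)
qed

text \<open>Up to bracketing, the braiding of L \<odot> L past L is c_12 c_23. Together with
  naturality this is what carries F from legs 12 to legs 23.\<close>

lemma hexagon_Op: "assoc_dag (c_LL (assoc_dag x)) = c_id (assoc_dag (id_c x))"
  using arg_cong[OF hexagon_left[OF L L L], of "\<lambda>f. blinfun_apply (Op C f) x"]
  by (simp add: inv_a comp_simps op_defs)

lemma naturality_Op: "c_LL (F_id x) = id_F (c_LL x)"
  using arg_cong[OF braiding_natural[OF LL LL L L homs(1,5)], of "\<lambda>f. blinfun_apply (Op C f) x"]
  by (simp add: comp_simps op_defs)

lemma inverses_Op:
  "assoc_dag (assoc x) = Op C (\<iota> (LL \<odot> L)) x" "assoc (assoc_dag y) = Op C (\<iota> (L \<odot> LL)) y"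
  "id_F (id_Fdag y) = Op C (\<iota> (L \<odot> LL)) y" "cdag_id (c_id x) = Op C (\<iota> (LL \<odot> L)) x"
proof -
  have eqs: "asc\<dagger> \<cdot> asc = \<iota> (LL \<odot> L)" "asc \<cdot> asc\<dagger> = \<iota> (L \<odot> LL)"
    using Assoc_unitary[OF L L L] by (simp_all add: unitary_def)
  show "assoc_dag (assoc x) = Op C (\<iota> (LL \<odot> L)) x" "assoc (assoc_dag y) = Op C (\<iota> (L \<odot> LL)) y"
    unfolding eqs[symmetric] by (simp_all add: comp_simps op_defs)
  have "(\<iota> L \<otimes> F) \<cdot> (\<iota> L \<otimes> F\<dagger>) = \<iota> (L \<odot> LL)"
    using F_unitary TenM_Comp[of L L L LL LL LL "\<iota> L" "\<iota> L" "F\<dagger>" F] Comp_Id[of L L "\<iota> L"]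
    by (simp add: unitary_def TenM_Id)
  from this[symmetric] show "id_F (id_Fdag y) = Op C (\<iota> (L \<odot> LL)) y"
    by (simp add: comp_simps op_defs)
  have "(cL\<dagger> \<otimes> \<iota> L) \<cdot> (cL \<otimes> \<iota> L) = \<iota> (LL \<odot> L)"
    using c_unitary[OF L L] TenM_Comp[of LL LL LL L L L cL "cL\<dagger>" "\<iota> L" "\<iota> L"] Comp_Id[of L L "\<iota> L"]
    by (simp add: unitary_def TenM_Id)
  from this[symmetric] show "cdag_id (c_id x) = Op C (\<iota> (LL \<odot> L)) x"
    by (simp add: comp_simps op_defs)
qed

lemma absorb_Op:
  "assoc_dag (Op C (\<iota> (L \<odot> LL)) x) = assoc_dag x" "assoc (Op C (\<iota> (LL \<odot> L)) x) = assoc x"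
  "Op C (\<iota> (LL \<odot> L)) (F_id x) = F_id x" "Op C (\<iota> (L \<odot> LL)) (id_c x) = id_c x"
  "Op C (\<iota> (L \<odot> LL)) (c_LL x) = c_LL x" "c_LL (Op C (\<iota> (LL \<odot> L)) x) = c_LL x"
  "Op C (\<iota> (LL \<odot> L)) (assoc_dag x) = assoc_dag x" "F_id (Op C (\<iota> (LL \<odot> L)) x) = F_id x"
  "id_F (Op C (\<iota> (L \<odot> LL)) x) = id_F x"
  unfolding op_defs
  by (rule Op_Op_Id[where X = "L \<odot> LL" and Y = "LL \<odot> L"] Op_Op_Id[where X = "LL \<odot> L" and Y = "L \<odot> LL"]
      Op_Op_Id[where X = "LL \<odot> L" and Y = "LL \<odot> L"] Op_Op_Id[where X = "L \<odot> LL" and Y = "L \<odot> LL"]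
      Op_Id_Op[where X = "L \<odot> LL" and Y = "LL \<odot> L"] Op_Id_Op[where X = "LL \<odot> L" and Y = "L \<odot> LL"]
      Op_Id_Op[where X = "LL \<odot> L" and Y = "LL \<odot> L"] Op_Id_Op[where X = "L \<odot> LL" and Y = "L \<odot> LL"];
      simp)+

text \<open>$F_{12} c_{23} F_{12} = F_{23} F_{12} F_{23}^* c_{23}$\<close>

lemma braided_pentagon:
  "F_id (assoc_dag (id_c (assoc (F_id x)))) =
    assoc_dag (id_F (assoc (F_id (assoc_dag (id_Fdag (id_c (assoc x)))))))"
proof -
  \<comment> \<open>The pentagon equation is applied to the vector F_23^* c_23 x, so that its
    trailing F_23 cancels and c_12 meets c_23.\<close>
  have "assoc_dag (id_F (assoc (F_id (assoc_dag (id_Fdag (id_c (assoc x)))))))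
      = F_id (cdag_id (assoc_dag (id_F (assoc (c_id (assoc_dag (id_c (assoc x))))))))"
    by (simp add: pentagon_Op inverses_Op absorb_Op)
  also have "\<dots> = F_id (cdag_id (assoc_dag (id_F (c_LL x))))"
    by (simp add: hexagon_Op[symmetric] inverses_Op absorb_Op)
  also have "\<dots> = F_id (cdag_id (assoc_dag (c_LL (F_id x))))"
    by (simp add: naturality_Op)
  also have "assoc_dag (c_LL (F_id x)) = c_id (assoc_dag (id_c (assoc (F_id x))))"
    using hexagon_Op[of "assoc (F_id x)"] by (simp add: inverses_Op absorb_Op)
  also have "F_id (cdag_id (c_id (assoc_dag (id_c (assoc (F_id x)))))) =
      F_id (assoc_dag (id_c (assoc (F_id x))))"
    by (simp add: inverses_Op absorb_Op)
  finally show ?thesis ..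
qed

section \<open>Slices of F and of F_12\<close>

abbreviation "t \<equiv> Tv C L L"
abbreviation "tL \<equiv> Tv C LL L"
abbreviation "tR \<equiv> Tv C L LL"
abbreviation "\<H> \<equiv> Sp C L"
abbreviation "\<H>2 \<equiv> Sp C LL"

text \<open>Three kinds of slices: \<open>S\<close> removes the second leg of L \<odot> L,
  \<open>SL\<close> the third leg of (L \<odot> L) \<odot> L, and \<open>SR\<close> legs two and
  three of L \<odot> (L \<odot> L) together.\<close>

sublocale S: two_tensor_products \<H> \<H> \<H>2 \<H> \<H> \<H>2 t t
  by (rule two_tensor_products.intro; rule tensor_product_Tv[OF L L])

sublocale SL: two_tensor_products \<H>2 \<H> "Sp C (LL \<odot> L)" \<H>2 \<H> "Sp C (LL \<odot> L)" tL tL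
  by (rule two_tensor_products.intro; rule tensor_product_Tv[OF LL L])

sublocale SR: two_tensor_products \<H> \<H>2 "Sp C (L \<odot> LL)" \<H> \<H>2 "Sp C (L \<odot> LL)" tR tR
  by (rule two_tensor_products.intro; rule tensor_product_Tv[OF L LL])

abbreviation "\<F> \<equiv> Op C F"
abbreviation "\<A> \<equiv> A_hat C L F"

lemma Op_bops [simp]:
  "\<F> \<in> bop \<H>2 \<H>2" "Op C cL \<in> bop \<H>2 \<H>2"
  "assoc \<in> bop (Sp C (LL \<odot> L)) (Sp C (L \<odot> LL))" "assoc_dag \<in> bop (Sp C (L \<odot> LL)) (Sp C (LL \<odot> L))"
  "F_id \<in> bop (Sp C (LL \<odot> L)) (Sp C (LL \<odot> L))" "id_c \<in> bop (Sp C (L \<odot> LL)) (Sp C (L \<odot> LL))"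
  unfolding op_defs by (rule Op_in_bop; simp)+

lemma A_hat_eq: "\<A> = closed_cspan {S.vector_slice \<F> u v | u v. u \<in> \<H> \<and> v \<in> \<H>}"
  unfolding A_hat_def by (rule S.closed_cspan_slices) simp

lemma csubspace_A_hat: "csubspace \<A>" and closed_A_hat: "closed \<A>"
  by (simp_all add: A_hat_def csubspace_closed_cspan closed_closed_cspan)

lemma vector_slice_in_A_hat: "u \<in> \<H> \<Longrightarrow> v \<in> \<H> \<Longrightarrow> S.vector_slice \<F> u v \<in> \<A>"
  unfolding A_hat_eq by (rule subsetD[OF closed_cspan_superset]) blast

lemma A_hat_bop: "\<A> \<subseteq> bop \<H> \<H>"
  unfolding A_hat_eq
proof (rule closed_cspan_minimal[OF _ csubspace_bop[OF S.dom.H] closed_bop[OF S.dom.H]])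
  show "{S.vector_slice \<F> u v | u v. u \<in> \<H> \<and> v \<in> \<H>} \<subseteq> bop \<H> \<H>"
    using S.vector_slice_bop[OF Op_bops(1)] by blast
qed

lemma assoc_apply:
  "x \<in> \<H> \<Longrightarrow> y \<in> \<H> \<Longrightarrow> z \<in> \<H> \<Longrightarrow> blinfun_apply assoc (tL (t x y) z) = tR x (t y z)"
  by (simp add: op_defs Tv_Assoc)

lemma assoc_dag_apply:
  assumes "x \<in> \<H>" "y \<in> \<H>" "z \<in> \<H>"
  shows "blinfun_apply assoc_dag (tR x (t y z)) = tL (t x y) z"
proof -
  have "tL (t x y) z \<in> Sp C (LL \<odot> L)"
    using assms by (intro SL.dom.tensor_in S.dom.tensor_in)
  thus ?thesis
    using inverses_Op(1)[of "tL (t x y) z"] assms by (simp add: assoc_apply Op_Id)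
qed

lemma cinner_assoc:
  "w \<in> Sp C (L \<odot> LL) \<Longrightarrow> z \<in> Sp C (LL \<odot> L) \<Longrightarrow>
    cinner w (blinfun_apply assoc z) = cinner (blinfun_apply assoc_dag w) z"
  unfolding op_defs by (rule Op_Dag[symmetric, of "LL \<odot> L" "L \<odot> LL"]) simp_all

lemma F_id_apply: "\<zeta> \<in> \<H>2 \<Longrightarrow> z \<in> \<H> \<Longrightarrow> blinfun_apply F_id (tL \<zeta> z) = tL (blinfun_apply \<F> \<zeta>) z"
  using Tv_natural[OF LL LL L L, of F "\<iota> L" \<zeta> z] by (simp add: op_defs Op_Id)

lemma id_c_apply: "x \<in> \<H> \<Longrightarrow> \<zeta> \<in> \<H>2 \<Longrightarrow> blinfun_apply id_c (tR x \<zeta>) = tR x (blinfun_apply (Op C cL) \<zeta>)"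
  using Tv_natural[OF L L LL LL, of "\<iota> L" cL x \<zeta>] by (simp add: op_defs Op_Id)

lemma id_Fdag_apply: "x \<in> \<H> \<Longrightarrow> \<zeta> \<in> \<H>2 \<Longrightarrow> blinfun_apply id_Fdag (tR x \<zeta>) = tR x (blinfun_apply (Op C (F\<dagger>)) \<zeta>)"
  using Tv_natural[OF L L LL LL, of "\<iota> L" "F\<dagger>" x \<zeta>] by (simp add: op_defs Op_Id)

lemma Op_F_dag: "\<zeta> \<in> \<H>2 \<Longrightarrow> blinfun_apply \<F> (blinfun_apply (Op C (F\<dagger>)) \<zeta>) = \<zeta>"
  using F_unitary Op_Comp_apply[of LL LL LL "F\<dagger>" F \<zeta>] by (simp add: unitary_def Op_Id)

lemma cinner_F:
  "\<xi> \<in> \<H>2 \<Longrightarrow> \<eta> \<in> \<H>2 \<Longrightarrow> cinner \<xi> (blinfun_apply \<F> \<eta>) = cinner (blinfun_apply (Op C (F\<dagger>)) \<xi>) \<eta>"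
  by (rule Op_Dag[symmetric, of LL LL]) simp_all

lemma cinner_F_id:
  assumes "\<xi> \<in> Sp C (LL \<odot> L)" "\<eta> \<in> Sp C (LL \<odot> L)"
  shows "cinner \<xi> (blinfun_apply F_id \<eta>) = cinner (blinfun_apply (Op C (F\<dagger> \<otimes> \<iota> L)) \<xi>) \<eta>"
proof -
  have "(F \<otimes> \<iota> L)\<dagger> = F\<dagger> \<otimes> \<iota> L"
    using TenM_Dag[of LL LL L L F "\<iota> L"] by (simp add: Dag_Id)
  thus ?thesis
    using Op_Dag[of "LL \<odot> L" "LL \<odot> L" "F \<otimes> \<iota> L" \<eta> \<xi>] assms by (simp add: op_defs)
qed

lemma Op_F_dag_in: "blinfun_apply (Op C (F\<dagger>)) \<zeta> \<in> \<H>2"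
  by (rule Op_in_Sp[of LL LL]) simp_all

lemma F_in: "blinfun_apply \<F> \<zeta> \<in> \<H>2"
  by (rule Op_in_Sp[of LL LL]) simp_all

lemma transported_F_id_bop:
  "assoc o\<^sub>L F_id o\<^sub>L assoc_dag \<in> bop (Sp C (L \<odot> LL)) (Sp C (L \<odot> LL))"
  by (intro bop_compose) (rule Op_bops)+

lemma transported_id_c_bop:
  "assoc_dag o\<^sub>L id_c o\<^sub>L assoc \<in> bop (Sp C (LL \<odot> L)) (Sp C (LL \<odot> L))"
  by (intro bop_compose) (rule Op_bops)+

text \<open>F_12 leaves the third leg alone, so a product functional contributes there only the
  scalar <q, q'>.\<close>

lemma slice_F_id_tensors:
  assumes p: "p \<in> \<H>" "q \<in> \<H>" "p' \<in> \<H>" "q' \<in> \<H>"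
  shows "SR.vector_slice (assoc o\<^sub>L F_id o\<^sub>L assoc_dag) (t p q) (t p' q') = cinner q q' *\<^sub>C S.vector_slice \<F> p p'"
proof (rule SR.vector_slice_eqI[OF transported_F_id_bop])
  show "cinner q q' *\<^sub>C S.vector_slice \<F> p p' \<in> bop \<H> \<H>"
    by (intro complex_vector.subspace_scale[OF csubspace_bop[OF S.dom.H]] S.vector_slice_bop Op_bops)
  fix x x' assume x: "x \<in> \<H>" "x' \<in> \<H>"
  have "cinner x' (blinfun_apply (SR.vector_slice (assoc o\<^sub>L F_id o\<^sub>L assoc_dag) (t p q) (t p' q')) x) =
      cinner (tR x' (t p q)) (blinfun_apply assoc (tL (blinfun_apply \<F> (t x p')) q'))"
    using x p by (simp add: SR.cinner_vector_slice[OF transported_F_id_bop] S.dom.tensor_in assoc_dag_apply F_id_apply)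
  also have "\<dots> = cinner (tL (t x' p) q) (tL (blinfun_apply \<F> (t x p')) q')"
    using x p by (simp add: cinner_assoc SR.dom.tensor_in S.dom.tensor_in SL.dom.tensor_in F_in assoc_dag_apply)
  also have "\<dots> = cinner (t x' p) (blinfun_apply \<F> (t x p')) * cinner q q'"
    using x p by (simp add: SL.dom.cinner_tensor S.dom.tensor_in F_in)
  finally show "cinner x' (blinfun_apply (cinner q q' *\<^sub>C S.vector_slice \<F> p p') x) =
      cinner x' (blinfun_apply (SR.vector_slice (assoc o\<^sub>L F_id o\<^sub>L assoc_dag) (t p q) (t p' q')) x)"
    using x p by (simp add: cinner_scaleC_right S.cinner_vector_slice)
qed

text \<open>Elementary tensors span a dense subspace, and slices depend boundedly on each vector.
  The right vector is freed before the left one; both extensions rest on \<open>A_hat\<close> being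
  a closed subspace.\<close>

lemma slice_F_id_in_A_hat:
  assumes "\<xi> \<in> \<H>2" "\<eta> \<in> \<H>2"
  shows "SR.vector_slice (assoc o\<^sub>L F_id o\<^sub>L assoc_dag) \<xi> \<eta> \<in> \<A>"
proof -
  let ?X = "assoc o\<^sub>L F_id o\<^sub>L assoc_dag"
  have cspan: "\<zeta> \<in> closed_cspan {t x y | x y. x \<in> \<H> \<and> y \<in> \<H>}" if "\<zeta> \<in> \<H>2" for \<zeta>
    using that S.dom.closed_cspan_tensors by simp
  have 1: "SR.vector_slice ?X (t p q) \<eta> \<in> \<A>" if "p \<in> \<H>" "q \<in> \<H>" for p q
  proof (rule closed_cspan_induct[OF cspan[OF assms(2)] SR.bounded_linear_vector_slice_right
        [OF transported_F_id_bop] _ _ csubspace_A_hat closed_A_hat])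
    show "\<exists>b. SR.vector_slice ?X (t p q) (a *\<^sub>C x) = b *\<^sub>C SR.vector_slice ?X (t p q) x" for a x
      using SR.vector_slice_scale_right[OF transported_F_id_bop] by blast
    show "SR.vector_slice ?X (t p q) x \<in> \<A>" if "x \<in> {t x y | x y. x \<in> \<H> \<and> y \<in> \<H>}" for x
      using that \<open>p \<in> \<H>\<close> \<open>q \<in> \<H>\<close>
      by (auto simp: slice_F_id_tensors
          intro!: complex_vector.subspace_scale[OF csubspace_A_hat] vector_slice_in_A_hat)
  qed
  show ?thesis
  proof (rule closed_cspan_induct[OF cspan[OF assms(1)] SR.bounded_linear_vector_slice_left
        [OF transported_F_id_bop] _ _ csubspace_A_hat closed_A_hat])
    show "\<exists>b. SR.vector_slice ?X (a *\<^sub>C x) \<eta> = b *\<^sub>C SR.vector_slice ?X x \<eta>" for a x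
      using SR.vector_slice_scale_left[OF transported_F_id_bop] by blast
    show "SR.vector_slice ?X x \<eta> \<in> \<A>" if "x \<in> {t x y | x y. x \<in> \<H> \<and> y \<in> \<H>}" for x
      using that 1 by blast
  qed
qed

text \<open>This is 1 \<otimes> D for D the slice of c by u and v: c_23 leaves the first leg alone,
  so slicing off the third leg keeps an identity there.\<close>

definition amplified_c where
  "amplified_c u v = SL.vector_slice (assoc_dag o\<^sub>L id_c o\<^sub>L assoc) u v"

lemma amplified_c_bop: "amplified_c u v \<in> bop \<H>2 \<H>2"
  unfolding amplified_c_def by (rule SL.vector_slice_bop[OF transported_id_c_bop])

lemma c_in: "blinfun_apply (Op C cL) \<zeta> \<in> \<H>2"
  by (rule Op_in_Sp[of LL LL]) simp_all

lemma cinner_assoc_dag: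
  assumes "w \<in> Sp C (L \<odot> LL)" "z \<in> Sp C (LL \<odot> L)"
  shows "cinner z (blinfun_apply assoc_dag w) = cinner (blinfun_apply assoc z) w"
  using arg_cong[OF cinner_assoc[OF assms], of cnj]
  by (simp add: cinner_commute[of z] cinner_commute[of _ w])

lemma amplified_c_tensor:
  assumes u: "u \<in> \<H>" "v \<in> \<H>" and x: "x \<in> \<H>" "y \<in> \<H>"
  shows "blinfun_apply (amplified_c u v) (t x y) = t x (blinfun_apply (S.vector_slice (Op C cL) u v) y)"
proof (rule S.dom.eq_on_tensors)
  have V_in: "blinfun_apply (S.vector_slice (Op C cL) u v) y \<in> \<H>"
    by (rule bopD(2)[OF S.vector_slice_bop]) simp
  show "blinfun_apply (amplified_c u v) (t x y) \<in> \<H>2"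
    by (rule bopD(2)[OF amplified_c_bop])
  show "t x (blinfun_apply (S.vector_slice (Op C cL) u v) y) \<in> \<H>2"
    using x V_in by (rule_tac S.dom.tensor_in)
  fix p q assume p: "p \<in> \<H>" "q \<in> \<H>"
  have "cinner (t p q) (blinfun_apply (amplified_c u v) (t x y)) =
      cinner (tL (t p q) u) (blinfun_apply assoc_dag (tR x (blinfun_apply (Op C cL) (t y v))))"
    unfolding amplified_c_def using u x p
    by (simp add: SL.cinner_vector_slice[OF transported_id_c_bop] S.dom.tensor_in assoc_apply id_c_apply)
  also have "\<dots> = cinner (tR p (t q u)) (tR x (blinfun_apply (Op C cL) (t y v)))"
    using u x p
    by (simp add: cinner_assoc_dag S.dom.tensor_in SR.dom.tensor_in SL.dom.tensor_in c_in assoc_apply)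
  also have "\<dots> = cinner p x * cinner (t q u) (blinfun_apply (Op C cL) (t y v))"
    using u x p by (simp add: SR.dom.cinner_tensor S.dom.tensor_in c_in)
  also have "\<dots> = cinner (t p q) (t x (blinfun_apply (S.vector_slice (Op C cL) u v) y))"
    using u x p V_in by (simp add: S.dom.cinner_tensor S.cinner_vector_slice)
  finally show "cinner (t p q) (blinfun_apply (amplified_c u v) (t x y)) =
      cinner (t p q) (t x (blinfun_apply (S.vector_slice (Op C cL) u v) y))" .
qed

lemma F_dag_tensor:
  assumes "\<zeta> \<in> \<H>2" "z \<in> \<H>"
  shows "blinfun_apply (Op C (F\<dagger> \<otimes> \<iota> L)) (tL \<zeta> z) = tL (blinfun_apply (Op C (F\<dagger>)) \<zeta>) z"
  using Tv_natural[OF LL LL L L, of "F\<dagger>" "\<iota> L" \<zeta> z] assms by (simp add: Op_Id)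

lemma cinner_id_F:
  assumes "\<xi> \<in> Sp C (L \<odot> LL)" "\<eta> \<in> Sp C (L \<odot> LL)"
  shows "cinner \<xi> (blinfun_apply id_F \<eta>) = cinner (blinfun_apply id_Fdag \<xi>) \<eta>"
proof -
  have "(\<iota> L \<otimes> F)\<dagger> = \<iota> L \<otimes> F\<dagger>"
    using TenM_Dag[of L L LL LL "\<iota> L" F] by (simp add: Dag_Id)
  thus ?thesis
    using Op_Dag[of "L \<odot> LL" "L \<odot> LL" "\<iota> L \<otimes> F" \<eta> \<xi>] assms by (simp add: op_defs)
qed

text \<open>The left side is the slice of F_12 c_23 F_12 over legs two and three by p \<otimes> u
  and q \<otimes> v. After \<open>braided_pentagon\<close>, the outer F_23 becomes an adjoint on p
  \<otimes> u, while F_23^* c_23 acts on q \<otimes> v; only F_12 is left to be sliced.\<close>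

lemma slice_amplified_c:
  assumes u: "u \<in> \<H>" "v \<in> \<H>" and ab: "p \<in> \<H>" "q \<in> \<H>"
  shows "S.vector_slice (\<F> o\<^sub>L amplified_c u v o\<^sub>L \<F>) p q =
    SR.vector_slice (assoc o\<^sub>L F_id o\<^sub>L assoc_dag) (blinfun_apply (Op C (F\<dagger>)) (t p u))
      (blinfun_apply (Op C (F\<dagger>)) (blinfun_apply (Op C cL) (t q v)))"
    (is "S.vector_slice ?G p q = SR.vector_slice ?X ?\<xi> ?\<eta>")
proof -
  have G: "?G \<in> bop \<H>2 \<H>2"
    by (rule bop_compose[OF bop_compose[OF Op_bops(1) amplified_c_bop] Op_bops(1)])
  show ?thesis
  proof (rule S.vector_slice_eqI[OF G SR.vector_slice_bop[OF transported_F_id_bop]])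
    fix x x' assume x: "x \<in> \<H>" "x' \<in> \<H>"
    let ?z = "tL (t x q) v" and ?z' = "tL (t x' p) u"
    have z: "?z \<in> Sp C (LL \<odot> L)" "?z' \<in> Sp C (LL \<odot> L)"
      using x u ab by (simp_all add: SL.dom.tensor_in S.dom.tensor_in)
    have op_in: "blinfun_apply assoc w \<in> Sp C (L \<odot> LL)" "blinfun_apply assoc_dag w \<in> Sp C (LL \<odot> L)"
      "blinfun_apply F_id w \<in> Sp C (LL \<odot> L)" "blinfun_apply id_F w \<in> Sp C (L \<odot> LL)" for w
      by (simp_all add: op_defs Op_in_Sp[of "LL \<odot> L" "L \<odot> LL"] Op_in_Sp[of "L \<odot> LL" "LL \<odot> L"]
          Op_in_Sp[of "LL \<odot> L" "LL \<odot> L"] Op_in_Sp[of "L \<odot> LL" "L \<odot> LL"])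
    have "cinner x' (blinfun_apply (S.vector_slice ?G p q) x) =
        cinner (blinfun_apply (Op C (F\<dagger>)) (t x' p))
          (blinfun_apply (amplified_c u v) (blinfun_apply \<F> (t x q)))"
      using x ab
      by (simp add: S.cinner_vector_slice[OF G] cinner_F S.dom.tensor_in bopD(2)[OF amplified_c_bop])
    \<comment> \<open>Undoing the slice restores u and v as third legs, and F and its adjoint become
      F_12 and its adjoint.\<close>
    also have "\<dots> = cinner (blinfun_apply (Op C (F\<dagger> \<otimes> \<iota> L)) ?z') (assoc_dag (id_c (assoc (F_id ?z))))"
      unfolding amplified_c_def using x u ab
      by (simp add: SL.cinner_vector_slice[OF transported_id_c_bop] Op_F_dag_in F_in S.dom.tensor_in
          F_dag_tensor F_id_apply)
    also have "\<dots> = cinner ?z' (F_id (assoc_dag (id_c (assoc (F_id ?z)))))"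
      using z op_in by (simp add: cinner_F_id)
    also have "\<dots> = cinner ?z' (assoc_dag (id_F (assoc (F_id (assoc_dag (id_Fdag (id_c (assoc ?z))))))))"
      by (simp only: braided_pentagon)
    \<comment> \<open>F_23 crosses to the left as its adjoint, where it meets only the legs p and
      u.\<close>
    also have "\<dots> = cinner (id_Fdag (assoc ?z')) (assoc (F_id (assoc_dag (id_Fdag (id_c (assoc ?z))))))"
      using z op_in by (simp add: cinner_assoc_dag cinner_id_F)
    also have "\<dots> = cinner x' (blinfun_apply (SR.vector_slice ?X ?\<xi> ?\<eta>) x)"
      using x u ab
      by (simp add: SR.cinner_vector_slice[OF transported_F_id_bop] assoc_apply id_c_apply id_Fdag_apply
          Op_F_dag_in c_in S.dom.tensor_in)
    finally show "cinner x' (blinfun_apply (SR.vector_slice ?X ?\<xi> ?\<eta>) x) =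
        cinner x' (blinfun_apply (S.vector_slice ?G p q) x)" ..
  qed
qed

text \<open>The induction over the span carries along an operator \<open>G\<close> acting as 1
  \<otimes> D, so that linear combinations of slices of c keep both an amplification and membership
  in \<open>A_hat\<close>.\<close>

lemma amplification_in_A_hat:
  assumes pq: "p \<in> \<H>" "q \<in> \<H>"
    and D: "D \<in> cspan {S.vector_slice (Op C cL) u v | u v. u \<in> \<H> \<and> v \<in> \<H>}"
  shows "D \<in> bop \<H> \<H> \<and> (\<exists>G\<in>bop \<H>2 \<H>2.
    (\<forall>x\<in>\<H>. \<forall>y\<in>\<H>. blinfun_apply G (t x y) = t x (blinfun_apply D y)) \<and>
    S.vector_slice (\<F> o\<^sub>L G o\<^sub>L \<F>) p q \<in> \<A>)"
  using D
proof (induction rule: complex_vector.span_induct_alt)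
  case base
  have "blinfun_apply 0 (t x y) = t x (blinfun_apply 0 y)" if "x \<in> \<H>" "y \<in> \<H>" for x y
    using S.dom.tensor_scale_right[OF that, of 0] by (simp add: complex_vector.scale_zero_left)
  moreover have "S.vector_slice (\<F> o\<^sub>L 0 o\<^sub>L \<F>) p q = 0"
    by (rule blinfun_eqI) (simp add: S.vector_slice_def blinfun.zero_right)
  ultimately show ?case
    using complex_vector.subspace_0[OF csubspace_bop[OF S.dom.H]]
      complex_vector.subspace_0[OF csubspace_bop[OF S.dom.T]]
      complex_vector.subspace_0[OF csubspace_A_hat] by (metis)
next
  case (step b V D)
  then obtain u v where V: "V = S.vector_slice (Op C cL) u v" "u \<in> \<H>" "v \<in> \<H>" by blast
  from step obtain G where D: "D \<in> bop \<H> \<H>" and G: "G \<in> bop \<H>2 \<H>2"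
    "\<And>x y. x \<in> \<H> \<Longrightarrow> y \<in> \<H> \<Longrightarrow> blinfun_apply G (t x y) = t x (blinfun_apply D y)"
    "S.vector_slice (\<F> o\<^sub>L G o\<^sub>L \<F>) p q \<in> \<A>" by blast
  have V': "V \<in> bop \<H> \<H>"
    unfolding V by (rule S.vector_slice_bop) simp
  let ?G = "b *\<^sub>C amplified_c u v + G"
  have "?G \<in> bop \<H>2 \<H>2"
    by (intro complex_vector.subspace_add[OF csubspace_bop[OF S.dom.T]]
        complex_vector.subspace_scale[OF csubspace_bop[OF S.dom.T]] amplified_c_bop G)
  moreover have "b *\<^sub>C V + D \<in> bop \<H> \<H>"
    by (intro complex_vector.subspace_add[OF csubspace_bop[OF S.dom.H]]
        complex_vector.subspace_scale[OF csubspace_bop[OF S.dom.H]] V' D)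
  moreover have "blinfun_apply ?G (t x y) = t x (blinfun_apply (b *\<^sub>C V + D) y)"
    if "x \<in> \<H>" "y \<in> \<H>" for x y
    using that V bopD(2)[OF V'] bopD(2)[OF D] hilbert_subspaceD(4)[OF S.dom.H]
    by (simp add: blinfun.add_left amplified_c_tensor G S.dom.tensor_add_right
        S.dom.tensor_scale_right)
  moreover have "S.vector_slice (\<F> o\<^sub>L ?G o\<^sub>L \<F>) p q \<in> \<A>"
  proof -
    have "\<F> o\<^sub>L ?G o\<^sub>L \<F> = b *\<^sub>C (\<F> o\<^sub>L amplified_c u v o\<^sub>L \<F>) + (\<F> o\<^sub>L G o\<^sub>L \<F>)"
      using bopD(1)[OF Op_bops(1)]
      by (intro blinfun_eqI) (simp add: blinfun.add_left blinfun.add_right complex_linear_def)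
    moreover have "S.vector_slice (\<F> o\<^sub>L amplified_c u v o\<^sub>L \<F>) p q \<in> \<A>"
      using V pq by (simp add: slice_amplified_c slice_F_id_in_A_hat Op_F_dag_in)
    ultimately show ?thesis
      using G(3) by (simp add: S.vector_slice_add S.vector_slice_scale
          complex_vector.subspace_add[OF csubspace_A_hat]
          complex_vector.subspace_scale[OF csubspace_A_hat])
  qed
  ultimately show ?case by blast
qed

text \<open>For fixed p and q the slice of F X F is norm-continuous in X. An approximation of k by D
  is an equally good approximation of 1 \<otimes> k by the amplification of D, by
  \<open>norm_amplification_le\<close>; since \<open>A_hat\<close> is closed, the limit stays
  inside.\<close>

lemma vector_slice_mult_in_A_hat:
  assumes "p \<in> \<H>" "x0 \<in> \<H>" "y0 \<in> \<H>" "q \<in> \<H>"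
  shows "S.vector_slice \<F> p x0 o\<^sub>L S.vector_slice \<F> y0 q \<in> \<A>"
proof -
  let ?V = "{S.vector_slice (Op C cL) u v | u v. u \<in> \<H> \<and> v \<in> \<H>}"
  define k where "k = rank_one x0 y0"
  \<comment> \<open>Creation by x0 after the adjoint of creation by y0: precisely what stands
    between the two copies of F in the product of the slices, and equal to 1 \<otimes> k on
    elementary tensors.\<close>
  define K where "K = S.dom.tensor_right x0 o\<^sub>L adj (S.dom.tensor_right y0)"
  have "k \<in> compact_ops \<H> \<H>"
    unfolding k_def by (rule rank_one_compact_ops[OF S.dom.H assms(2,3)])
  hence k_bop: "k \<in> bop \<H> \<H>"
    by (simp add: compact_ops_def)
  have "k \<in> closed_cspan ?V"
    using \<open>k \<in> compact_ops \<H> \<H>\<close> semi_regular L S.closed_cspan_slices[OF Op_bops(2)]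
    unfolding semi_regular_def by blast
  hence k: "k \<in> closure (cspan ?V)" by (simp add: closed_cspan_def)
  have K_bop: "K \<in> bop \<H>2 \<H>2"
    unfolding K_def
    by (rule bop_compose[OF S.dom.tensor_right_bop bop_adj[OF S.dom.H S.dom.tensor_right_bop]])
  have K_tensor: "blinfun_apply K (t x y) = t x (blinfun_apply k y)" if "x \<in> \<H>" "y \<in> \<H>" for x y
    using that assms hilbert_subspaceD(4)[OF S.dom.H]
    by (simp add: K_def k_def S.dom.adj_tensor_right_tensor S.dom.tensor_right_simp rank_one_apply
        S.dom.tensor_scale_left S.dom.tensor_scale_right)
  have prod: "S.vector_slice \<F> p x0 o\<^sub>L S.vector_slice \<F> y0 q = S.vector_slice (\<F> o\<^sub>L K o\<^sub>L \<F>) p q"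
    by (rule blinfun_eqI) (simp add: S.vector_slice_def K_def)
  \<comment> \<open>The first summand bounds the norm of X \<mapsto> slice of F X F; adding 1 keeps
    \<open>B\<close> positive, so that e / B makes sense as a tolerance even when p or q is
    0.\<close>
  define B where "B = norm p * (norm \<F> * norm \<F>) * norm q + 1"
  have "0 < B" by (simp add: B_def add_nonneg_pos)
  have "\<exists>Z\<in>\<A>. dist Z (S.vector_slice (\<F> o\<^sub>L K o\<^sub>L \<F>) p q) < e" if "0 < e" for e
  proof -
    obtain D where D: "D \<in> cspan ?V" "dist D k < e / B"
      using k \<open>0 < e\<close> \<open>0 < B\<close> unfolding closure_approachable by (meson divide_pos_pos)
    obtain G where G: "D \<in> bop \<H> \<H>" "G \<in> bop \<H>2 \<H>2"
      "\<And>x y. x \<in> \<H> \<Longrightarrow> y \<in> \<H> \<Longrightarrow> blinfun_apply G (t x y) = t x (blinfun_apply D y)"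
      "S.vector_slice (\<F> o\<^sub>L G o\<^sub>L \<F>) p q \<in> \<A>"
      using amplification_in_A_hat[OF assms(1,4) D(1)] by blast
    have GK: "G - K \<in> bop \<H>2 \<H>2"
      by (intro complex_vector.subspace_diff[OF csubspace_bop[OF S.dom.T]] G K_bop)
    have "norm (G - K) \<le> norm (D - k)"
    proof (rule S.dom.norm_amplification_le[OF GK])
      show "D - k \<in> bop \<H> \<H>"
        by (intro complex_vector.subspace_diff[OF csubspace_bop[OF S.dom.H]] G k_bop)
      show "blinfun_apply (G - K) (t x y) = t x (blinfun_apply (D - k) y)"
        if xy: "x \<in> \<H>" "y \<in> \<H>" for x y
      proof -
        have "t x (blinfun_apply D y) = t x (blinfun_apply (D - k) y + blinfun_apply k y)"
          by (simp add: blinfun.diff_left)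
        also have "\<dots> = t x (blinfun_apply (D - k) y) + t x (blinfun_apply k y)"
          using xy bopD(2)[OF G(1)] bopD(2)[OF k_bop] hilbert_subspaceD(3)[OF S.dom.H]
          by (intro S.dom.tensor_add_right) (simp_all add: blinfun.diff_left)
        finally show ?thesis
          using xy by (simp add: G K_tensor blinfun.diff_left)
      qed
    qed
    have "S.vector_slice (\<F> o\<^sub>L G o\<^sub>L \<F>) p q - S.vector_slice (\<F> o\<^sub>L K o\<^sub>L \<F>) p q
        = S.vector_slice (\<F> o\<^sub>L (G - K) o\<^sub>L \<F>) p q"
      unfolding S.vector_slice_diff[symmetric]
      by (rule arg_cong[where f = "\<lambda>A. S.vector_slice A p q"], rule blinfun_eqI)
        (simp add: blinfun.diff_left blinfun.diff_right)
    moreover have "norm (S.vector_slice (\<F> o\<^sub>L (G - K) o\<^sub>L \<F>) p q)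
        \<le> norm p * norm (\<F> o\<^sub>L (G - K) o\<^sub>L \<F>) * norm q"
      by (rule S.norm_vector_slice_le[OF bop_compose[OF bop_compose[OF Op_bops(1) GK] Op_bops(1)]])
    moreover have "norm (\<F> o\<^sub>L (G - K) o\<^sub>L \<F>) \<le> norm \<F> * norm (G - K) * norm \<F>"
      by (meson norm_blinfun_compose mult_right_mono norm_ge_zero order_trans)
    hence "norm p * norm (\<F> o\<^sub>L (G - K) o\<^sub>L \<F>) * norm q
        \<le> norm p * (norm \<F> * norm (G - K) * norm \<F>) * norm q"
      by (intro mult_left_mono mult_right_mono) auto
    moreover have "norm p * (norm \<F> * norm (G - K) * norm \<F>) * norm q \<le> B * norm (G - K)"
      by (simp add: B_def algebra_simps)
    moreover have "B * norm (G - K) < e"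
      using \<open>norm (G - K) \<le> norm (D - k)\<close> D(2) \<open>0 < B\<close>
      by (simp add: dist_norm field_simps) (smt (verit) mult_left_mono mult.commute)
    ultimately have "dist (S.vector_slice (\<F> o\<^sub>L G o\<^sub>L \<F>) p q) (S.vector_slice (\<F> o\<^sub>L K o\<^sub>L \<F>) p q) < e"
      by (simp add: dist_norm)
    with G(4) show ?thesis by blast
  qed
  hence "S.vector_slice (\<F> o\<^sub>L K o\<^sub>L \<F>) p q \<in> closure \<A>"
    unfolding closure_approachable by blast
  thus ?thesis
    using closed_A_hat by (simp add: prod)
qed

section \<open>Closure under products and non-degeneracy\<close>

lemma A_hat_mult:
  assumes S: "S \<in> \<A>" and T: "T \<in> \<A>"
  shows "S o\<^sub>L T \<in> \<A>"
proof -
  have 1: "S.vector_slice \<F> p x0 o\<^sub>L T \<in> \<A>" if p: "p \<in> \<H>" "x0 \<in> \<H>" for p x0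
  proof (rule closed_cspan_induct[OF T[unfolded A_hat_eq] bounded_bilinear.bounded_linear_right[OF
        bounded_bilinear_blinfun_compose]
        _ _ csubspace_A_hat closed_A_hat])
    show "\<exists>c. S.vector_slice \<F> p x0 o\<^sub>L (b *\<^sub>C X) = c *\<^sub>C (S.vector_slice \<F> p x0 o\<^sub>L X)" for b X
      using blinfun_compose_scaleC_right[OF bopD(1)[OF S.vector_slice_bop[OF Op_bops(1)]]] by blast
    show "S.vector_slice \<F> p x0 o\<^sub>L X \<in> \<A>" if "X \<in> {S.vector_slice \<F> u v | u v. u \<in> \<H> \<and> v \<in> \<H>}" for X
      using that vector_slice_mult_in_A_hat p by blast
  qed
  show ?thesis
  proof (rule closed_cspan_induct[OF S[unfolded A_hat_eq] bounded_bilinear.bounded_linear_left[OF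
        bounded_bilinear_blinfun_compose]
        _ _ csubspace_A_hat closed_A_hat])
    show "\<exists>c. (b *\<^sub>C X) o\<^sub>L T = c *\<^sub>C (X o\<^sub>L T)" for b X
      using blinfun_compose_scaleC_left by blast
    show "X o\<^sub>L T \<in> \<A>" if "X \<in> {S.vector_slice \<F> u v | u v. u \<in> \<H> \<and> v \<in> \<H>}" for X
      using that 1 by blast
  qed
qed

text \<open>The adjoint of creation by p, composed with F, sends x \<otimes> y to a slice of F
  applied to x, hence all of L \<otimes> L into the closed span. Surjectivity of F then makes every
  value of that adjoint available.\<close>

lemma A_hat_nondegenerate:
  "closed_cspan {blinfun_apply a x | a x. a \<in> \<A> \<and> x \<in> \<H>} = \<H>" (is "closed_cspan ?N = _")
proof
  show "closed_cspan ?N \<subseteq> \<H>"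
    by (rule closed_cspan_minimal)
      (use subsetD[OF A_hat_bop, THEN bopD(2)] S.dom.H in \<open>auto simp: hilbert_subspace_def\<close>)
  show "\<H> \<subseteq> closed_cspan ?N"
  proof
    fix p assume p: "p \<in> \<H>"
    let ?f = "\<lambda>\<zeta>. blinfun_apply (adj (S.dom.tensor_right p)) (blinfun_apply \<F> \<zeta>)"
    have f: "?f \<zeta> \<in> closed_cspan ?N" if "\<zeta> \<in> \<H>2" for \<zeta>
    proof (rule closed_cspan_induct[OF that[folded S.dom.closed_cspan_tensors] _ _ _
          csubspace_closed_cspan closed_closed_cspan])
      show "bounded_linear ?f"
        by (intro bounded_linear_compose[OF blinfun.bounded_linear_right]
            blinfun.bounded_linear_right)
      show "\<exists>c. ?f (b *\<^sub>C z) = c *\<^sub>C ?f z" for b z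
        using bopD(1)[OF Op_bops(1)] cinner_adj(2)[OF bopD(1)[OF S.dom.tensor_right_bop]]
        by (metis complex_linear_def)
      show "?f z \<in> closed_cspan ?N" if "z \<in> {t x y | x y. x \<in> \<H> \<and> y \<in> \<H>}" for z
      proof -
        from that obtain x y where xy: "z = t x y" "x \<in> \<H>" "y \<in> \<H>" by blast
        have "?f z = blinfun_apply (S.vector_slice \<F> p y) x"
          using xy by (simp add: S.vector_slice_def S.dom.tensor_right_simp)
        hence "?f z \<in> ?N"
          using vector_slice_in_A_hat[OF p xy(3)] xy(2) by blast
        thus ?thesis by (rule subsetD[OF closed_cspan_superset])
      qed
    qed
    \<comment> \<open>The vector fed to \<open>?f\<close> is the preimage F^* (p \<otimes> p);
      contracting p \<otimes> p with p returns p up to a scalar that vanishes only for p =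
      0.\<close>
    have "cinner p p *\<^sub>C p \<in> closed_cspan ?N"
      using f[OF Op_F_dag_in, of "t p p"] p
      by (simp add: Op_F_dag S.dom.tensor_in S.dom.adj_tensor_right_tensor)
    hence "inverse (cinner p p) *\<^sub>C cinner p p *\<^sub>C p \<in> closed_cspan ?N"
      by (rule complex_vector.subspace_scale[OF csubspace_closed_cspan])
    thus "p \<in> closed_cspan ?N"
      using complex_vector.subspace_0[OF csubspace_closed_cspan]
      by (cases "p = 0") (simp_all add: cinner_self)
  qed
qed

end

theorem proposition5:
  fixes C :: "('o, 'm::{complex_normed_vector, banach}, 'h::complex_hilbert) concrete_data"
    and c :: "'o \<Rightarrow> 'o \<Rightarrow> 'm" and L :: 'o and F :: 'm
  assumes "concrete_monoidal_wstar_category C"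
    and "braiding C c"
    and "semi_regular C c"
    and "L \<in> Ob C"
    and "multiplicative_unitary C c L F"
  shows "subalgebra_of_bop (Sp C L) (A_hat C L F) \<and>
    closed_cspan {blinfun_apply a x | a x. a \<in> A_hat C L F \<and> x \<in> Sp C L} = Sp C L"
proof -
  interpret braided_multiplicative_unitary C c L F
    using assms by (intro braided_multiplicative_unitary.intro
        braided_multiplicative_unitary_axioms.intro)
  show ?thesis
    using A_hat_bop csubspace_A_hat A_hat_mult A_hat_nondegenerate
    by (auto simp: subalgebra_of_bop_def)
qed

end
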